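(* Let $\theta$ be a real number which is not a rational number and not a quadratic irrationality. Let $\hat{\omega}=\hat{\omega}(\theta,\theta^2)$ be the uniform Diophantine exponent of the linear form $x_0+x_1\theta+x_2\theta^2$, and let $\omega_*=\omega_*(\theta)$ be the exponent of approximation of $\theta$ by algebraic numbers of degree at most $2$. Then $$ \omega_*\ \ge\ \hat{\omega}^2-\hat{\omega}+1 . $$
   Context: For $\mathbf{z}\in\mathbb{R}^3$, $|\mathbf{z}|$ denotes the Euclidean length. The uniform Diophantine exponent of the form $L(\mathbf{x})=x_0+x_1\theta+x_2\theta^2$ is $$ \hat{\omega}(\theta,\theta^2)=\sup\left\{\gamma:\ \limsup_{t\to\infty}\left(t^{\gamma}\min_{0<|\mathbf{x}|\le t}|L(\mathbf{x})|\right)<\infty\right\}, $$ where the minimum is over $\mathbf{x}=(x_0,x_1,x_2)\in\mathbb{Z}^3$. Further, $$ \omega_*(\theta)=\sup\left\{\gamma:\ \text{there exist infinitely many algebraic numbers } \xi \text{ of degree}\le 2 \text{ such that } |\theta-\xi|\le H(\xi)^{-\gamma}\right\}, $$ where $H(\xi)$ is the maximum of the absolute values of the coefficients of the canonical polynomial of $\xi$, i.e. its minimal polynomial over $\mathbb{Z}$ with coprime integer coefficients. (The exponent in this definition is $-\gamma$, not $-\gamma-1$.) Suprema are taken in the extended reals. *)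

theory Defs
  imports "HOL-Analysis.Analysis"
begin

section \<open>Canonical polynomials of algebraic numbers\<close>

definition is_canonical_poly :: "int poly \<Rightarrow> 'a::field_char_0 \<Rightarrow> bool" where
  "is_canonical_poly p x \<longleftrightarrow>
     p \<noteq> 0 \<and> poly (map_poly of_int p) x = 0 \<and>
     (\<forall>q. q \<noteq> 0 \<and> poly (map_poly of_int q) x = 0 \<longrightarrow> degree p \<le> degree q) \<and>
     content p = 1 \<and> lead_coeff p > 0"

text \<open>The sign normalisation makes the polynomial unique; it affects neither degree nor height.
  The value is meaningful only for algebraic arguments.\<close>

definition canonical_poly :: "'a::field_char_0 \<Rightarrow> int poly" where
  "canonical_poly x = (THE p. is_canonical_poly p x)"

definition alg_degree :: "'a::field_char_0 \<Rightarrow> nat" where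
  "alg_degree x = degree (canonical_poly x)"

definition alg_height :: "'a::field_char_0 \<Rightarrow> int" where
  "alg_height x = Max {\<bar>coeff (canonical_poly x) i\<bar> | i. i \<le> degree (canonical_poly x)}"

lemma map_poly_of_int_arith:
  fixes p q :: "int poly"
  shows "map_poly (of_int :: int \<Rightarrow> 'a::field_char_0) (p - q) = map_poly of_int p - map_poly of_int q"
    and "map_poly (of_int :: int \<Rightarrow> 'a) (smult c p) = smult (of_int c) (map_poly of_int p)"
    and "map_poly (of_int :: int \<Rightarrow> 'a) (- p) = - map_poly of_int p"
  by (simp_all add: poly_eq_iff coeff_map_poly)

lemma is_canonical_poly_unique:
  fixes x :: "'a::field_char_0"
  assumes p: "is_canonical_poly p x" and q: "is_canonical_poly q x"
  shows "p = q"
proof -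
  define r where "r = smult (lead_coeff q) p - smult (lead_coeff p) q"
  have deg: "degree p = degree q"
    using p q by (auto simp: is_canonical_poly_def intro!: antisym)
  have pos: "lead_coeff p > 0" "lead_coeff q > 0"
    using p q by (auto simp: is_canonical_poly_def)
  have cont: "content p = 1" "content q = 1"
    using p q by (auto simp: is_canonical_poly_def)
  have root: "poly (map_poly of_int r) x = 0"
    using p q by (simp add: r_def is_canonical_poly_def map_poly_of_int_arith)
  have "r = 0"
  proof (rule ccontr)
    assume nz: "r \<noteq> 0"
    have le: "degree r \<le> degree p"
      unfolding r_def using deg by (intro degree_diff_le) auto
    have "degree p \<le> degree r"
      using p nz root by (auto simp: is_canonical_poly_def)
    with le have "degree r = degree p" by simp
    moreover have "coeff r (degree p) = 0"
      by (simp add: r_def deg mult.commute)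
    ultimately show False using nz by (metis leading_coeff_0_iff)
  qed
  hence eq: "smult (lead_coeff q) p = smult (lead_coeff p) q" by (simp add: r_def)
  hence "content (smult (lead_coeff q) p) = content (smult (lead_coeff p) q)" by simp
  hence "lead_coeff q = lead_coeff p" using cont pos by simp
  with eq pos show ?thesis by (metis less_irrefl smult_cancel)
qed

lemma is_canonical_poly_exists:
  fixes x :: "'a::field_char_0"
  assumes "algebraic x"
  shows "\<exists>p. is_canonical_poly p x"
proof -
  let ?P = "\<lambda>p. p \<noteq> 0 \<and> poly (map_poly of_int p) x = 0"
  obtain p0 where "?P p0" using algebraicE'[OF assms] by blast
  then obtain p where p: "?P p" and min: "\<And>q. ?P q \<Longrightarrow> degree p \<le> degree q"
    using ex_has_least_nat[of ?P p0 degree] by blast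
  define q where "q = primitive_part p"
  have pq: "p = smult (content p) q" by (simp add: q_def)
  have c0: "content p \<noteq> 0" using p by simp
  have "poly (map_poly of_int p) x = of_int (content p) * poly (map_poly of_int q) x"
    by (subst pq) (simp add: map_poly_of_int_arith)
  hence q: "?P q" "degree q = degree p" "content q = 1"
    using p c0 by (auto simp: q_def)
  define s where "s = (if lead_coeff q > 0 then q else - q)"
  have m: "poly (map_poly of_int (- q)) x = 0"
    using q(1) by (simp add: map_poly_of_int_arith)
  have "content (- q) = 1"
    using content_smult[of "-1" q] q(3) by simp
  moreover have "lead_coeff q \<noteq> 0" using q(1) by (simp only: leading_coeff_0_iff) simp
  ultimately have "is_canonical_poly s x"
    using q m min by (auto simp: s_def is_canonical_poly_def not_less less_le)
  thus ?thesis ..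
qed

lemma is_canonical_poly_canonical_poly:
  "algebraic x \<Longrightarrow> is_canonical_poly (canonical_poly x) x"
  unfolding canonical_poly_def
  by (rule theI') (use is_canonical_poly_exists is_canonical_poly_unique in blast)

section \<open>Diophantine exponents\<close>

text \<open>Coordinates 1, 2, 3 of a vector carry the mathematical indices 0, 1, 2.\<close>

definition form_values :: "real \<Rightarrow> real \<Rightarrow> real set" where
  "form_values \<theta> t =
     {\<bar>x $ 1 + x $ 2 * \<theta> + x $ 3 * \<theta>\<^sup>2\<bar> | x :: real ^ 3.
        (\<forall>i. x $ i \<in> \<int>) \<and> 0 < norm x \<and> norm x \<le> t}"

lemma finite_form_values: "finite (form_values \<theta> t)"
proof -
  let ?X = "{x :: real ^ 3. (\<forall>i. x $ i \<in> \<int>) \<and> 0 < norm x \<and> norm x \<le> t}"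
  let ?F = "PiE (UNIV :: 3 set) (\<lambda>_. {- \<lceil>t\<rceil>..\<lceil>t\<rceil>})"
  have "?X \<subseteq> (\<lambda>f. \<chi> i. real_of_int (f i)) ` ?F"
  proof
    fix x assume x: "x \<in> ?X"
    have fl: "real_of_int \<lfloor>x $ i\<rfloor> = x $ i" for i
      using x by (auto elim!: Ints_cases)
    have "\<bar>x $ i\<bar> \<le> t" for i
      using x component_le_norm_cart[of x i] by auto
    hence "real_of_int \<bar>\<lfloor>x $ i\<rfloor>\<bar> \<le> t" for i
      unfolding of_int_abs fl .
    hence "\<bar>\<lfloor>x $ i\<rfloor>\<bar> \<le> \<lceil>t\<rceil>" for i
      by (metis le_of_int_ceiling of_int_le_iff order_trans)
    hence "(\<lambda>i. \<lfloor>x $ i\<rfloor>) \<in> ?F" by (auto simp: abs_le_iff) (smt (verit))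
    moreover have "x = (\<chi> i. real_of_int \<lfloor>x $ i\<rfloor>)" unfolding vec_eq_iff vec_lambda_beta fl by simp
    ultimately show "x \<in> (\<lambda>f. \<chi> i. real_of_int (f i)) ` ?F"
      by (intro image_eqI[where x = "\<lambda>i. \<lfloor>x $ i\<rfloor>"])
  qed
  moreover have "finite ?F" by (intro finite_PiE) auto
  ultimately have "finite ?X" by (rule finite_surj[rotated])
  moreover have "form_values \<theta> t = (\<lambda>x. \<bar>x $ 1 + x $ 2 * \<theta> + x $ 3 * \<theta>\<^sup>2\<bar>) ` ?X"
    by (auto simp: form_values_def)
  ultimately show ?thesis by simp
qed

lemma form_values_nonempty:
  assumes "t \<ge> 1"
  shows "form_values \<theta> t \<noteq> {}"
proof -
  have "\<forall>i. (axis 1 1 :: real ^ 3) $ i \<in> \<int>" by (auto simp: axis_def)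
  thus ?thesis using assms unfolding form_values_def
    by (auto intro!: exI[of _ "axis 1 1 :: real ^ 3"])
qed

text \<open>By the two lemmas above, the minimum below is a genuine one as soon as \<open>t \<ge> 1\<close>.\<close>

definition omega_hat :: "real \<Rightarrow> ereal" where
  "omega_hat \<theta> =
     Sup {ereal \<gamma> | \<gamma>.
       Limsup at_top (\<lambda>t::real. ereal (t powr \<gamma> * Min (form_values \<theta> t))) < \<infinity>}"

text \<open>The approximating algebraic numbers are complex. Non-real ones of degree 2 satisfy
  \<open>\<bar>\<theta> - \<xi>\<bar> \<ge> c / H(\<xi>)\<close> with an absolute constant \<open>c > 0\<close>, so only real ones matter for \<open>\<gamma> > 1\<close>.\<close>

definition omega_star :: "real \<Rightarrow> ereal" where
  "omega_star \<theta> =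
     Sup {ereal \<gamma> | \<gamma>.
       infinite {\<xi> :: complex. algebraic \<xi> \<and> alg_degree \<xi> \<le> 2 \<and>
         norm (complex_of_real \<theta> - \<xi>) \<le> real_of_int (alg_height \<xi>) powr (- \<gamma>)}}"

definition quadratic_irrational :: "real \<Rightarrow> bool" where
  "quadratic_irrational \<theta> \<longleftrightarrow> algebraic \<theta> \<and> alg_degree \<theta> = 2"

end

theory Submission
  imports Defs
begin

text \<open>Let \<open>\<gamma> \<ge> 2\<close> be admissible for the uniform exponent and suppose that only finitely many \<open>\<xi>\<close> satisfy
  \<open>\<bar>\<theta> - \<xi>\<bar> \<le> H(\<xi>) powr - (\<gamma>\<^sup>2 - \<gamma> + 1 - \<epsilon>)\<close>. A polynomial \<open>P\<close> of degree at most 2 has a root within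
  \<open>2 \<bar>P \<theta> / P' \<theta>\<bar>\<close> of \<open>\<theta>\<close>, so \<open>\<bar>P' \<theta>\<bar>\<close> is at most a constant times
  \<open>\<bar>P \<theta>\<bar> H(P) powr (\<gamma>\<^sup>2 - \<gamma> + 1 - \<epsilon>)\<close> for all integer \<open>P\<close>.
  Let \<open>z j\<close> be the minimal points of the linear form, \<open>X j\<close> their heights, and call \<open>j\<close> independent if
  \<open>z (j - 1)\<close>, \<open>z j\<close>, \<open>z (j + 1)\<close> are linearly independent, which happens infinitely often. As the
  determinant is a nonzero integer, \<open>X (j + 1)\<close> is at least of order \<open>X j powr (\<gamma> - 1)\<close>, and since
  the derivative at \<open>z j\<close> is small, the one at the next independent point \<open>z k\<close> has at least the order
  of \<open>X k * X j powr (\<gamma> - 1) / X (j + 1)\<close>. Comparing with the upper bound for that derivative gives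
  \<open>\<gamma> * u k + \<epsilon> * ln (X k) \<le> u j + O(1)\<close> for \<open>u j = ln (X (j + 1)) - (\<gamma> - 1) * ln (X j)\<close>, which
  is impossible because \<open>u\<close> is bounded below.\<close>

section \<open>Minimal points with small derivatives\<close>

text \<open>In the application the integer vector \<open>z j\<close> is the \<open>j\<close>-th minimal point of the form \<open>L\<close>, of
  height \<open>X j\<close>, and \<open>l j = L (z j)\<close>, \<open>p j = L' (z j)\<close>, \<open>q j\<close> is its last coordinate. Passing from the
  integer coordinates to \<open>(l, p, q)\<close> is unimodular, so determinants remain integers. The bound
  \<open>p_le_l\<close> is the negation of the claim, and the locale is contradictory.\<close>

locale approximation_sequence =
  fixes l p q X :: "nat \<Rightarrow> real" and \<gamma> \<epsilon> C K :: real
  assumes \<gamma>_ge: "2 \<le> \<gamma>" and \<epsilon>_pos: "0 < \<epsilon>" and \<epsilon>_le: "\<epsilon> \<le> 1/2"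
    and C_ge: "1 \<le> C" and K_ge: "1 \<le> K"
    and X_ge: "1 \<le> X j" and X_Suc: "X j \<le> X (Suc j)"
    and X_lim: "filterlim X at_top sequentially"
    and l_nonzero: "l j \<noteq> 0" and l_Suc: "\<bar>l (Suc j)\<bar> \<le> \<bar>l j\<bar>"
    and l_le: "\<bar>l j\<bar> \<le> C * X (Suc j) powr - \<gamma>"
    and p_le_l: "\<bar>p j\<bar> \<le> K * \<bar>l j\<bar> * X j powr (\<gamma>\<^sup>2 - \<gamma> + 1 - \<epsilon>)"
    and p_le: "\<bar>p j\<bar> \<le> K * X j" and q_le: "\<bar>q j\<bar> \<le> K * X j"
    and X_le: "X j \<le> K * (\<bar>p j\<bar> + \<bar>q j\<bar>)"
    and minor_ge: "1 \<le> \<bar>l j * p (Suc j) - l (Suc j) * p j\<bar> + \<bar>l j * q (Suc j) - l (Suc j) * q j\<bar>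
      + \<bar>p j * q (Suc j) - p (Suc j) * q j\<bar>"
    and det_Ints: "l i * (p j * q k - p k * q j) - p i * (l j * q k - l k * q j)
      + q i * (l j * p k - l k * p j) \<in> \<int>"
begin

section \<open>Minors and determinants in the coordinates \<open>(l, p, q)\<close>\<close>

definition lp :: "nat \<Rightarrow> nat \<Rightarrow> real" where "lp i j = l i * p j - l j * p i"
definition lq :: "nat \<Rightarrow> nat \<Rightarrow> real" where "lq i j = l i * q j - l j * q i"
definition pq :: "nat \<Rightarrow> nat \<Rightarrow> real" where "pq i j = p i * q j - p j * q i"
definition det3 :: "nat \<Rightarrow> nat \<Rightarrow> nat \<Rightarrow> real" where
  "det3 i j k = l i * pq j k - p i * lq j k + q i * lp j k"
definition independent :: "nat \<Rightarrow> bool" where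
  "independent j \<longleftrightarrow> 0 < j \<and> det3 (j - 1) j (Suc j) \<noteq> 0"

lemma X_pos: "0 < X j" using X_ge[of j] by linarith

lemma X_mono: "i \<le> j \<Longrightarrow> X i \<le> X j"
  using X_Suc by (rule lift_Suc_mono_le)

lemma eventually_small:
  assumes "0 < \<kappa>" "0 < \<delta>"
  shows "\<forall>\<^sub>F j in sequentially. M * X j powr - \<kappa> < \<delta>"
proof -
  have "(\<lambda>j. M * X j powr - \<kappa>) \<longlonglongrightarrow> M * 0"
    using assms by (intro tendsto_intros tendsto_neg_powr X_lim) auto
  thus ?thesis using assms(2) by (auto dest: order_tendstoD)
qed

text \<open>A crude exponent for \<open>p j\<close>; all that matters is \<open>m < \<gamma> - 1\<close>, where for \<open>\<gamma> = 2\<close> the assumption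
  \<open>p_le_l\<close> is needed.\<close>

definition m :: real where "m = min 1 ((\<gamma> - 1)\<^sup>2 - \<epsilon>)"

lemma m_bounds: "0 < m" "m \<le> 1" "m < \<gamma> - 1"
proof -
  have "1 \<le> (\<gamma> - 1)\<^sup>2" using \<gamma>_ge by (simp add: one_le_power)
  thus "0 < m" using \<epsilon>_le by (simp add: m_def)
  show "m \<le> 1" by (simp add: m_def)
  show "m < \<gamma> - 1"
  proof (cases "\<gamma> = 2")
    case True
    thus ?thesis using \<epsilon>_pos unfolding m_def by simp
  next
    case False
    thus ?thesis using \<gamma>_ge by (simp add: m_def)
  qed
qed

text \<open>The two entries of the minimum in \<open>m\<close> belong to two bounds:
  \<open>p_le_l\<close> together with \<open>l_le\<close> gives the exponent
  \<open>(\<gamma>\<^sup>2 - \<gamma> + 1 - \<epsilon>) - \<gamma> = (\<gamma> - 1)\<^sup>2 -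
  \<epsilon>\<close>, and \<open>p_le\<close> gives the exponent 1.\<close>

lemma p_le_powr: "\<bar>p j\<bar> \<le> K * C * X j powr m"
proof (cases "(\<gamma> - 1)\<^sup>2 - \<epsilon> \<le> 1")
  case True
  have "X (Suc j) powr - \<gamma> \<le> X j powr - \<gamma>"
    using X_Suc X_pos \<gamma>_ge by (intro powr_mono2') auto
  hence l': "\<bar>l j\<bar> \<le> C * X j powr - \<gamma>"
    using l_le[of j] C_ge by (smt (verit) mult_left_mono)
  have "\<bar>p j\<bar> \<le> K * (C * X j powr - \<gamma>) * X j powr (\<gamma>\<^sup>2 - \<gamma> + 1 - \<epsilon>)"
    by (rule order_trans[OF p_le_l]) (use l' K_ge in \<open>intro mult_mono; auto\<close>)
  also have "\<dots> = K * C * X j powr m"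
    using True by (simp add: m_def powr_add[symmetric] power2_eq_square algebra_simps)
  finally show ?thesis .
next
  case False
  hence "X j powr m = X j" using X_pos[of j] by (simp add: m_def)
  moreover have "K * X j \<le> K * C * X j"
    using K_ge C_ge X_pos[of j] by simp
  ultimately show ?thesis using p_le[of j] by simp
qed

text \<open>The minors that involve \<open>l\<close> inherit the factor
  \<open>\<bar>l j\<bar>\<close>, which dominates \<open>\<bar>l (Suc j)\<bar>\<close>; in
  \<open>lp\<close> the saving from \<open>m\<close> survives as well.\<close>

lemma minor_le:
  "\<bar>lq j (Suc j)\<bar> \<le> 2 * K * \<bar>l j\<bar> * X (Suc j)"
  "\<bar>lp j (Suc j)\<bar> \<le> 2 * K * C * \<bar>l j\<bar> * X (Suc j) powr m"
  "\<bar>pq j (Suc j)\<bar> \<le> 2 * K\<^sup>2 * X j * X (Suc j)"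
proof -
  have q: "\<bar>q j\<bar> \<le> K * X (Suc j)" "\<bar>q (Suc j)\<bar> \<le> K * X (Suc j)"
    using q_le[of j] q_le[of "Suc j"] X_Suc[of j] K_ge by (auto intro: order_trans mult_left_mono)
  have p: "\<bar>p j\<bar> \<le> K * C * X (Suc j) powr m" "\<bar>p (Suc j)\<bar> \<le> K * C * X (Suc j) powr m"
  proof -
    have "X j powr m \<le> X (Suc j) powr m"
      using X_Suc X_pos[of j] m_bounds by (intro powr_mono2) auto
    thus "\<bar>p j\<bar> \<le> K * C * X (Suc j) powr m"
      using p_le_powr[of j] K_ge C_ge by (auto intro: order_trans mult_left_mono)
  qed (rule p_le_powr)
  have "\<bar>lq j (Suc j)\<bar> \<le> \<bar>l j\<bar> * \<bar>q (Suc j)\<bar> + \<bar>l (Suc j)\<bar> * \<bar>q j\<bar>"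
    unfolding lq_def by (metis abs_mult abs_triangle_ineq4)
  also have "\<dots> \<le> \<bar>l j\<bar> * (K * X (Suc j)) + \<bar>l j\<bar> * (K * X (Suc j))"
    using q l_Suc[of j] by (intro add_mono mult_mono) auto
  finally show "\<bar>lq j (Suc j)\<bar> \<le> 2 * K * \<bar>l j\<bar> * X (Suc j)" by (simp add: algebra_simps)
  have "\<bar>lp j (Suc j)\<bar> \<le> \<bar>l j\<bar> * \<bar>p (Suc j)\<bar> + \<bar>l (Suc j)\<bar> * \<bar>p j\<bar>"
    unfolding lp_def by (metis abs_mult abs_triangle_ineq4)
  also have "\<dots> \<le> \<bar>l j\<bar> * (K * C * X (Suc j) powr m) + \<bar>l j\<bar> * (K * C * X (Suc j) powr m)"
    using p l_Suc[of j] by (intro add_mono mult_mono) auto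
  finally show "\<bar>lp j (Suc j)\<bar> \<le> 2 * K * C * \<bar>l j\<bar> * X (Suc j) powr m" by (simp add: algebra_simps)
  have "\<bar>pq j (Suc j)\<bar> \<le> \<bar>p j\<bar> * \<bar>q (Suc j)\<bar> + \<bar>p (Suc j)\<bar> * \<bar>q j\<bar>"
    unfolding pq_def by (metis abs_mult abs_triangle_ineq4)
  also have "\<dots> \<le> (K * X j) * (K * X (Suc j)) + (K * X (Suc j)) * (K * X j)"
    using p_le q_le K_ge X_pos[of j] X_pos[of "Suc j"] by (intro add_mono mult_mono) auto
  finally show "\<bar>pq j (Suc j)\<bar> \<le> 2 * K\<^sup>2 * X j * X (Suc j)"
    by (simp add: algebra_simps power2_eq_square)
qed

section \<open>Coplanar runs and the infinitude of independent points\<close>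

lemma coplanar_step:
  assumes "det3 i a b = 0" "det3 j a b = 0" "det3 i j k = 0"
    and "lp i j \<noteq> 0 \<or> lq i j \<noteq> 0 \<or> pq i j \<noteq> 0"
  shows "det3 k a b = 0"
proof -
  \<comment> \<open>Each minor of \<open>i\<close> and \<open>j\<close> times
    \<open>det3 k a b\<close> is a combination of the three vanishing determinants, so a single
    nonzero minor, meaning that the vectors \<open>i\<close> and \<open>j\<close> span a plane, is
    enough.\<close>
  have 1: "lp i j * det3 k a b = lp a b * det3 i j k + (l k * p j - l j * p k) * det3 i a b
     + (l i * p k - l k * p i) * det3 j a b"
    unfolding det3_def lp_def lq_def pq_def by algebra
  have 2: "lq i j * det3 k a b = lq a b * det3 i j k + (l k * q j - l j * q k) * det3 i a b
     + (l i * q k - l k * q i) * det3 j a b"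
    unfolding det3_def lp_def lq_def pq_def by algebra
  have 3: "pq i j * det3 k a b = pq a b * det3 i j k + (p k * q j - p j * q k) * det3 i a b
     + (p i * q k - p k * q i) * det3 j a b"
    unfolding det3_def lp_def lq_def pq_def by algebra
  show ?thesis using assms 1 2 3 by auto
qed

lemma minor_sum_ge: "1 \<le> \<bar>lp j (Suc j)\<bar> + \<bar>lq j (Suc j)\<bar> + \<bar>pq j (Suc j)\<bar>"
  using minor_ge[of j] unfolding lp_def lq_def pq_def .

lemma minor_nonzero: "lp j (Suc j) \<noteq> 0 \<or> lq j (Suc j) \<noteq> 0 \<or> pq j (Suc j) \<noteq> 0"
  using minor_sum_ge[of j] by auto

text \<open>Without an independent index in between, each new vector stays in the plane of its two
  predecessors, hence in that of \<open>j\<close> and \<open>Suc j\<close>. The induction carries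
  two consecutive determinants because \<open>coplanar_step\<close> consumes both.\<close>

lemma coplanar_run:
  assumes "\<And>i. j < i \<Longrightarrow> i < k \<Longrightarrow> \<not> independent i" "j \<le> i" "i < k"
  shows "det3 i j (Suc j) = 0 \<and> det3 (Suc i) j (Suc j) = 0"
  using assms(2,3)
proof (induction i rule: dec_induct)
  case base
  show ?case unfolding det3_def lp_def lq_def pq_def by (simp add: algebra_simps)
next
  case (step i)
  have "det3 i (Suc i) (Suc (Suc i)) = 0"
    using assms(1)[of "Suc i"] step by (simp add: independent_def)
  moreover have "det3 i j (Suc j) = 0" "det3 (Suc i) j (Suc j) = 0" using step by simp_all
  ultimately show ?case using minor_nonzero[of i] coplanar_step by blast
qed

text \<open>If independence ceased at \<open>N\<close>, all later vectors would stay in one plane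
  with a fixed normal direction, whereas \<open>minor_sum_ge\<close> keeps the normal vectors away
  from 0.\<close>

lemma infinitely_many_independent: "\<exists>j\<ge>N. independent j"
proof (rule ccontr)
  assume "\<not> ?thesis"
  hence no: "\<not> independent j" if "N \<le> j" for j using that by auto
  have det0: "det3 j N (Suc N) = 0" "det3 (Suc j) N (Suc N) = 0" if "N \<le> j" for j
    using coplanar_run[of N "Suc j" j] no that by auto
  define u v w where "u = lp N (Suc N)" and "v = lq N (Suc N)" and "w = pq N (Suc N)"
  \<comment> \<open>All minors are proportional to \<open>(u, v, w)\<close>, but those involving \<open>l\<close> tend to 0.\<close>
  have uv: "u \<noteq> 0 \<or> v \<noteq> 0"
  proof (rule ccontr)
    assume "\<not> ?thesis"
    \<comment> \<open>Expansion of a determinant with a repeated row: since \<open>l N\<close> is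
      nonzero, \<open>u = v = 0\<close> would force \<open>w = 0\<close>.\<close>
    moreover have "l N * w = p N * v - q N * u"
      unfolding u_def v_def w_def lp_def lq_def pq_def by algebra
    ultimately show False using l_nonzero[of N] minor_nonzero[of N]
      unfolding u_def v_def w_def by simp
  qed
  \<comment> \<open>The ratio of the full sum of minors to the part involving \<open>l\<close>; by
    proportionality it serves for all \<open>j\<close> from \<open>N\<close> on.\<close>
  define M where "M = (\<bar>u\<bar> + \<bar>v\<bar> + \<bar>w\<bar>) / (\<bar>u\<bar> + \<bar>v\<bar>)"
  have M: "\<bar>lp j (Suc j)\<bar> + \<bar>lq j (Suc j)\<bar> + \<bar>pq j (Suc j)\<bar>
      = M * (\<bar>lp j (Suc j)\<bar> + \<bar>lq j (Suc j)\<bar>)" if "N \<le> j" for j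
  proof -
    have "u * pq j (Suc j) = w * lp j (Suc j) + p j * det3 (Suc j) N (Suc N) - p (Suc j) * det3 j N (Suc N)"
      "v * pq j (Suc j) = w * lq j (Suc j) + q j * det3 (Suc j) N (Suc N) - q (Suc j) * det3 j N (Suc N)"
      unfolding u_def v_def w_def lp_def lq_def pq_def det3_def by algebra+
    hence "u * pq j (Suc j) = w * lp j (Suc j)" "v * pq j (Suc j) = w * lq j (Suc j)"
      using det0 that by auto
    hence "\<bar>u\<bar> * \<bar>pq j (Suc j)\<bar> = \<bar>w\<bar> * \<bar>lp j (Suc j)\<bar>" "\<bar>v\<bar> * \<bar>pq j (Suc j)\<bar> = \<bar>w\<bar> * \<bar>lq j (Suc j)\<bar>"
      by (metis abs_mult)+
    moreover have "\<bar>u\<bar> + \<bar>v\<bar> > 0" using uv by auto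
    ultimately show ?thesis unfolding M_def by (simp add: field_simps)
  qed
  have "M > 0" unfolding M_def using uv by (intro divide_pos_pos) auto
  have "\<forall>\<^sub>F j in sequentially. M * 4 * K * C\<^sup>2 * X j powr - (\<gamma> - 1) < 1"
    using \<gamma>_ge by (intro eventually_small) auto
  then obtain j where j: "N \<le> j" "M * 4 * K * C\<^sup>2 * X (Suc j) powr - (\<gamma> - 1) < 1"
    unfolding eventually_sequentially by (metis le_SucI max.cobounded1 max.cobounded2)
  let ?x = "X (Suc j)"
  have x1: "?x powr (- \<gamma> + 1) = ?x powr - \<gamma> * ?x" using powr_add[of ?x "- \<gamma>" 1] X_pos[of "Suc j"] by simp
  have "\<bar>lq j (Suc j)\<bar> \<le> 2 * K * (C * ?x powr - \<gamma>) * ?x"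
    by (rule order_trans[OF minor_le(1)]) (use l_le K_ge X_pos[of "Suc j"] in \<open>auto intro!: mult_right_mono mult_left_mono\<close>)
  also have "\<dots> \<le> 2 * K * (C * C * ?x powr - \<gamma>) * ?x"
    using K_ge C_ge X_pos[of "Suc j"] by (intro mult_right_mono mult_left_mono) auto
  finally have 1: "\<bar>lq j (Suc j)\<bar> \<le> 2 * K * C\<^sup>2 * ?x powr - (\<gamma> - 1)"
    using x1 by (simp add: power2_eq_square algebra_simps)
  have "?x powr m \<le> ?x powr 1" using m_bounds X_ge[of "Suc j"] by (intro powr_mono) auto
  hence xm: "?x powr m \<le> ?x" using X_pos[of "Suc j"] by simp
  have "\<bar>lp j (Suc j)\<bar> \<le> 2 * K * C * (C * ?x powr - \<gamma>) * ?x"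
    by (rule order_trans[OF minor_le(2)]) (use l_le K_ge C_ge xm in \<open>intro mult_mono; simp\<close>)
  hence 2: "\<bar>lp j (Suc j)\<bar> \<le> 2 * K * C\<^sup>2 * ?x powr - (\<gamma> - 1)"
    using x1 by (simp add: power2_eq_square algebra_simps)
  have "\<bar>lp j (Suc j)\<bar> + \<bar>lq j (Suc j)\<bar> \<le> 4 * K * C\<^sup>2 * ?x powr - (\<gamma> - 1)" using 1 2 by linarith
  hence "M * (\<bar>lp j (Suc j)\<bar> + \<bar>lq j (Suc j)\<bar>) \<le> M * (4 * K * C\<^sup>2 * ?x powr - (\<gamma> - 1))"
    using \<open>M > 0\<close> by simp
  hence "M * (\<bar>lp j (Suc j)\<bar> + \<bar>lq j (Suc j)\<bar>) < 1" using j(2) by (simp add: mult.assoc)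
  thus False using minor_sum_ge[of j] M[OF j(1)] by linarith
qed

text \<open>The first independent index after \<open>j\<close> works: its own vector still lies in
  the plane of \<open>j\<close> and \<open>Suc j\<close>, and only its successor leaves the current
  plane.\<close>

lemma next_independent:
  assumes "independent j"
  obtains k where "j < k" "independent k" "det3 k j (Suc j) = 0"
proof -
  define k where "k = (LEAST k. Suc j \<le> k \<and> independent k)"
  have k: "Suc j \<le> k" "independent k"
    using LeastI_ex[OF infinitely_many_independent[of "Suc j", simplified]] unfolding k_def by auto
  have "\<not> independent i" if "j < i" "i < k" for i
    using not_less_Least[of i "\<lambda>k. Suc j \<le> k \<and> independent k"] that unfolding k_def by auto
  hence "det3 (Suc (k - 1)) j (Suc j) = 0" using coplanar_run[of j k "k - 1"] k by auto
  moreover have "Suc (k - 1) = k" using k(1) by linarith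
  ultimately show ?thesis using that k Suc_le_lessD by metis
qed

section \<open>Asymptotic estimates at independent points\<close>

text \<open>The determinant of \<open>j - 1\<close>, \<open>j\<close>, \<open>Suc j\<close> is a
  nonzero integer. Expanded along the row \<open>j - 1\<close>, the terms with \<open>lq\<close> and
  \<open>lp\<close> tend to 0 because \<open>m < \<gamma> - 1\<close>, so the term
  \<open>l (j - 1) * pq j (Suc j)\<close> is at least 1/2, while \<open>l_le\<close> makes
  \<open>l (j - 1)\<close> small in terms of \<open>X j\<close>.\<close>

lemma pq_ge: "\<forall>\<^sub>F j in sequentially. independent j \<longrightarrow> X j powr \<gamma> \<le> 2 * C * \<bar>pq j (Suc j)\<bar>"
proof -
  have "\<forall>\<^sub>F j in sequentially. 4 * K\<^sup>2 * C\<^sup>2 * X j powr - (\<gamma> - 1 - m) < 1/2"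
    using m_bounds by (intro eventually_small) auto
  hence "\<forall>\<^sub>F j in sequentially. 4 * K\<^sup>2 * C\<^sup>2 * X (Suc j) powr - (\<gamma> - 1 - m) < 1/2"
    by (rule eventually_compose_filterlim[OF _ filterlim_Suc])
  thus ?thesis
  proof eventually_elim
    case (elim j)
    show ?case
    proof
      assume ind: "independent j"
      define i where "i = j - 1"
      have j: "j = Suc i" and d: "det3 i j (Suc j) \<noteq> 0"
        using ind by (auto simp: independent_def i_def)
      let ?x = "X (Suc j)"
      have x: "?x > 0" "X i \<le> ?x" by (auto simp: X_pos j intro: X_mono)
      have "X i powr m \<le> ?x powr m" using x X_pos[of i] m_bounds by (intro powr_mono2) auto
      hence p: "\<bar>p i\<bar> \<le> K * C * ?x powr m"
        using p_le_powr[of i] K_ge C_ge by (auto intro: order_trans mult_left_mono)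
      have q: "\<bar>q i\<bar> \<le> K * ?x" using q_le[of i] x K_ge by (auto intro: order_trans mult_left_mono)
      have 1: "\<bar>p i * lq j (Suc j)\<bar> \<le> (K * C * ?x powr m) * (2 * K * (C * ?x powr - \<gamma>) * ?x)"
        unfolding abs_mult using p l_le[of j] K_ge C_ge x
        by (intro mult_mono order_trans[OF minor_le(1)] mult_left_mono) auto
      have 2: "\<bar>q i * lp j (Suc j)\<bar> \<le> (K * ?x) * (2 * K * C * (C * ?x powr - \<gamma>) * ?x powr m)"
        unfolding abs_mult using q l_le[of j] K_ge C_ge x
        by (intro mult_mono order_trans[OF minor_le(2)] mult_left_mono) auto
      have "?x powr (m - \<gamma> + 1) = ?x powr m * ?x powr - \<gamma> * ?x"
        using x by (simp add: powr_add powr_diff powr_minus field_simps)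
      hence "\<bar>p i * lq j (Suc j)\<bar> + \<bar>q i * lp j (Suc j)\<bar> \<le> 4 * K\<^sup>2 * C\<^sup>2 * ?x powr - (\<gamma> - 1 - m)"
        using 1 2 by (simp add: power2_eq_square algebra_simps)
      hence small: "\<bar>p i * lq j (Suc j)\<bar> + \<bar>q i * lp j (Suc j)\<bar> < 1/2" using elim by linarith
      have "1 \<le> \<bar>det3 i j (Suc j)\<bar>" using d det_Ints[of i j "Suc j"]
        by (intro Ints_nonzero_abs_ge1) (auto simp: det3_def lp_def lq_def pq_def)
      hence "1/2 \<le> \<bar>l i * pq j (Suc j)\<bar>" using small unfolding det3_def by linarith
      also have "\<dots> \<le> (C * X j powr - \<gamma>) * \<bar>pq j (Suc j)\<bar>"
        unfolding abs_mult using l_le[of i] by (intro mult_right_mono) (auto simp: j)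
      finally show "X j powr \<gamma> \<le> 2 * C * \<bar>pq j (Suc j)\<bar>"
        using X_pos[of j] by (simp add: powr_minus field_simps)
    qed
  qed
qed

text \<open>\<open>B\<close> is the product of the factor \<open>2 * C\<close> from
  \<open>pq_ge\<close> and \<open>2 * K\<^sup>2\<close> from \<open>minor_le\<close>; likewise
  \<open>A\<close> is \<open>2 * C\<close> times the factor \<open>16 * K ^ 3\<close> that arises in
  \<open>p_next_ge\<close>.\<close>

definition B :: real where "B = 4 * C * K\<^sup>2"
definition A :: real where "A = 32 * C * K ^ 3"

lemma B_ge: "1 \<le> B"
proof -
  have "1 * 1 * 1 \<le> 4 * C * K\<^sup>2" using C_ge K_ge by (intro mult_mono one_le_power) auto
  thus ?thesis by (simp add: B_def)
qed

lemma A_ge: "1 \<le> A"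
proof -
  have "1 * 1 * 1 \<le> 32 * C * K ^ 3" using C_ge K_ge by (intro mult_mono one_le_power) auto
  thus ?thesis by (simp add: A_def)
qed

text \<open>The lower bound \<open>pq_ge\<close> is compared with the trivial upper bound for
  \<open>pq\<close>, and one factor \<open>X j\<close> cancels.\<close>

lemma growth: "\<forall>\<^sub>F j in sequentially. independent j \<longrightarrow> X j powr (\<gamma> - 1) \<le> B * X (Suc j)"
  using pq_ge
proof eventually_elim
  case (elim j)
  show ?case
  proof
    assume "independent j"
    hence "X j powr \<gamma> \<le> 2 * C * \<bar>pq j (Suc j)\<bar>" using elim by simp
    also have "\<dots> \<le> 2 * C * (2 * K\<^sup>2 * X j * X (Suc j))"
      using minor_le(3) C_ge by (intro mult_left_mono) auto
    finally have "X j powr (\<gamma> - 1) * X j \<le> B * X (Suc j) * X j"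
      using powr_add[of "X j" "\<gamma> - 1" 1] X_pos[of j] by (simp add: B_def mult_ac)
    thus "X j powr (\<gamma> - 1) \<le> B * X (Suc j)" using X_pos[of j] by simp
  qed
qed

text \<open>Here the exponent in \<open>p_le_l\<close> matters: after \<open>l_le\<close>, the left
  side contains \<open>X (Suc j) powr - (\<gamma> - 1)\<close>, which \<open>growth\<close> replaces
  by \<open>X j powr - ((\<gamma> - 1)\<^sup>2)\<close>. As \<open>\<gamma>\<^sup>2 - \<gamma> + 1 -
  (\<gamma> - 1)\<^sup>2 = \<gamma>\<close>, it has order at most
  \<open>X j powr (\<gamma> - \<epsilon>)\<close>, and \<open>pq_ge\<close> beats this by the power
  \<open>\<epsilon>\<close>.\<close>

lemma p_small: "\<forall>\<^sub>F j in sequentially. independent j \<longrightarrow> 4 * K * X (Suc j) * \<bar>p j\<bar> \<le> \<bar>pq j (Suc j)\<bar>"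
proof -
  let ?g = "\<gamma> - 1"
  have "\<forall>\<^sub>F j in sequentially. 8 * K\<^sup>2 * C\<^sup>2 * B powr ?g * X j powr - \<epsilon> < 1"
    using \<epsilon>_pos by (intro eventually_small) auto
  with growth pq_ge show ?thesis
  proof eventually_elim
    case (elim j)
    show ?case
    proof
      assume ind: "independent j"
      let ?x = "X j" and ?y = "X (Suc j)"
      have pos: "?x > 0" "?y > 0" "B > 0" using X_pos B_ge by auto
      have "?x powr ?g / B \<le> ?y" using elim(1) ind pos by (simp add: field_simps)
      hence "?y powr - ?g \<le> (?x powr ?g / B) powr - ?g"
        using pos \<gamma>_ge by (intro powr_mono2') auto
      also have "\<dots> = B powr ?g * ?x powr - (?g\<^sup>2)"
        using pos powr_add[of B "1 - \<gamma>" "\<gamma> - 1"]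
        by (simp add: powr_divide powr_powr power2_eq_square field_simps)
      finally have y: "?y powr - ?g \<le> B powr ?g * ?x powr - (?g\<^sup>2)" .
      have "\<bar>p j\<bar> \<le> K * (C * ?y powr - \<gamma>) * ?x powr (\<gamma>\<^sup>2 - \<gamma> + 1 - \<epsilon>)"
        using p_le_l[of j] l_le[of j] K_ge by (elim order_trans) (intro mult_right_mono mult_left_mono; simp)
      hence "?y * \<bar>p j\<bar> \<le> ?y * (K * (C * ?y powr - \<gamma>) * ?x powr (\<gamma>\<^sup>2 - \<gamma> + 1 - \<epsilon>))"
        using pos by (intro mult_left_mono) auto
      also have "\<dots> = K * C * ?y powr - ?g * ?x powr (\<gamma>\<^sup>2 - \<gamma> + 1 - \<epsilon>)"
        using powr_add[of ?y "- \<gamma>" 1] pos by (simp add: mult_ac)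
      also have "\<dots> \<le> K * C * (B powr ?g * ?x powr - (?g\<^sup>2)) * ?x powr (\<gamma>\<^sup>2 - \<gamma> + 1 - \<epsilon>)"
        using y K_ge C_ge by (intro mult_right_mono mult_left_mono) auto
      also have "\<dots> = K * C * B powr ?g * ?x powr (\<gamma> - \<epsilon>)"
        by (simp add: powr_add[symmetric] mult.assoc) (simp add: power2_eq_square algebra_simps)
      finally have "4 * K * ?y * \<bar>p j\<bar> \<le> 4 * K * (K * C * B powr ?g * ?x powr (\<gamma> - \<epsilon>))"
        using K_ge by (simp add: mult.assoc)
      also have "\<dots> * (2 * C) = (8 * K\<^sup>2 * C\<^sup>2 * B powr ?g * ?x powr - \<epsilon>) * ?x powr \<gamma>"
        using powr_add[of ?x "-\<epsilon>" \<gamma>] by (simp add: power2_eq_square mult_ac)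
      hence "4 * K * (K * C * B powr ?g * ?x powr (\<gamma> - \<epsilon>)) * (2 * C) \<le> 1 * ?x powr \<gamma>"
        using elim(3) by (metis less_imp_le mult_right_mono powr_ge_zero)
      hence "4 * K * (K * C * B powr ?g * ?x powr (\<gamma> - \<epsilon>)) * (2 * C) \<le> \<bar>pq j (Suc j)\<bar> * (2 * C)"
        using elim(2) ind by (simp add: mult_ac)
      hence "4 * K * (K * C * B powr ?g * ?x powr (\<gamma> - \<epsilon>)) \<le> \<bar>pq j (Suc j)\<bar>"
        by (rule mult_right_le_imp_le) (use C_ge in simp)
      finally show "4 * K * ?y * \<bar>p j\<bar> \<le> \<bar>pq j (Suc j)\<bar>" .
    qed
  qed
qed

text \<open>At \<gamma> = 2, \<open>growth\<close> bounds the ratio of consecutive heights only by a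
  fixed constant. If the ratio were bounded, \<open>p (Suc j)\<close> would also be of order at most
  \<open>X j powr m\<close>; \<open>p_small\<close> absorbs the other product in \<open>pq\<close>,
  so \<open>pq\<close> would have order at most \<open>X j powr (m + 1)\<close>, against
  \<open>pq_ge\<close>.\<close>

lemma ratio_ge: "\<forall>\<^sub>F j in sequentially. independent j \<longrightarrow> 16 * K\<^sup>2 * X j \<le> X (Suc j)"
proof -
  have "\<forall>\<^sub>F j in sequentially. 64 * K ^ 4 * C\<^sup>2 * X j powr - (\<gamma> - 1 - m) < 1"
    using m_bounds by (intro eventually_small) auto
  with p_small pq_ge show ?thesis
  proof eventually_elim
    case (elim j)
    show ?case
    proof (intro impI, rule ccontr)
      assume ind: "independent j" and "\<not> 16 * K\<^sup>2 * X j \<le> X (Suc j)"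
      let ?x = "X j" and ?y = "X (Suc j)" and ?W = "\<bar>pq j (Suc j)\<bar>"
      have pos: "?x > 0" "?y > 0" using X_pos by auto
      have Kx: "0 \<le> K * ?x" using pos K_ge by simp
      have K2: "1 \<le> 16 * K\<^sup>2" using one_le_power[OF K_ge, of 2] by simp
      have "?y powr m \<le> (16 * K\<^sup>2 * ?x) powr m"
        using \<open>\<not> _\<close> pos m_bounds by (intro powr_mono2) auto
      also have "\<dots> = (16 * K\<^sup>2) powr m * ?x powr m" using pos by (simp add: powr_mult)
      also have "(16 * K\<^sup>2) powr m \<le> (16 * K\<^sup>2) powr 1" using K2 m_bounds by (intro powr_mono) auto
      finally have ym: "?y powr m \<le> 16 * K\<^sup>2 * ?x powr m" using K2 by (simp add: mult_right_mono)
      have "?W \<le> \<bar>p j\<bar> * \<bar>q (Suc j)\<bar> + \<bar>p (Suc j)\<bar> * \<bar>q j\<bar>"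
        unfolding pq_def by (metis abs_mult abs_triangle_ineq4)
      also have "\<dots> \<le> \<bar>p j\<bar> * (K * ?y) + (K * C * (16 * K\<^sup>2 * ?x powr m)) * (K * ?x)"
        using q_le p_le_powr[of "Suc j"] ym K_ge C_ge pos Kx
        by (intro add_mono mult_mono order_trans[OF p_le_powr] mult_left_mono) auto
      also have "\<dots> = K * ?y * \<bar>p j\<bar> + 16 * K ^ 4 * C * ?x powr (m + 1)"
        using pos by (simp add: powr_add power2_eq_square power4_eq_xxxx mult_ac)
      finally have "?W \<le> 32 * K ^ 4 * C * ?x powr (m + 1)"
        using elim(1) ind by simp
      hence "?x powr \<gamma> \<le> 2 * C * (32 * K ^ 4 * C * ?x powr (m + 1))"
        using elim(2) ind C_ge by (smt (verit) mult_left_mono)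
      also have "\<dots> = (64 * K ^ 4 * C\<^sup>2 * ?x powr - (\<gamma> - 1 - m)) * ?x powr \<gamma>"
        using powr_add[of ?x "- (\<gamma> - 1 - m)" \<gamma>] by (simp add: power2_eq_square mult_ac add.commute)
      also have "\<dots> < 1 * ?x powr \<gamma>" using elim(3) pos by (intro mult_strict_right_mono) auto
      finally show False by simp
    qed
  qed
qed

lemma l_antimono: "i \<le> j \<Longrightarrow> \<bar>l j\<bar> \<le> \<bar>l i\<bar>"
  using l_Suc by (rule lift_Suc_antimono_le)

text \<open>If \<open>p k\<close> has the order of \<open>X k\<close>, this is
  \<open>growth\<close>. Otherwise \<open>q k\<close> has that order. Since \<open>p j\<close> is
  small, \<open>lp j (Suc j)\<close> must be large, and coplanarity of \<open>k\<close> with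
  \<open>j\<close> and \<open>Suc j\<close> then passes the size of \<open>q k\<close> on to
  \<open>p k\<close>.\<close>

lemma p_next_ge:
  "\<forall>\<^sub>F j in sequentially. \<forall>k. independent j \<longrightarrow> j < k \<longrightarrow> det3 k j (Suc j) = 0 \<longrightarrow>
     X k * X j powr (\<gamma> - 1) \<le> A * X (Suc j) * \<bar>p k\<bar>"
  using growth p_small ratio_ge pq_ge
proof eventually_elim
  case (elim j)
  show ?case
  proof (intro allI impI)
    fix k assume ind: "independent j" and k: "j < k" and det: "det3 k j (Suc j) = 0"
    let ?x = "X j" and ?y = "X (Suc j)" and ?W = "\<bar>pq j (Suc j)\<bar>"
    have pos: "?x > 0" "?y > 0" "X k > 0" "K > 0" using X_pos K_ge by auto
    have yk: "?y \<le> X k" using k by (intro X_mono) auto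
    show "X k * ?x powr (\<gamma> - 1) \<le> A * ?y * \<bar>p k\<bar>"
    proof (cases "X k \<le> 2 * K * \<bar>p k\<bar>")
      case True
      hence "X k * ?x powr (\<gamma> - 1) \<le> (2 * K * \<bar>p k\<bar>) * (B * ?y)"
        using elim(1) ind pos by (intro mult_mono) auto
      also have "\<dots> = 8 * (C * K ^ 3 * ?y * \<bar>p k\<bar>)"
        by (simp add: B_def power2_eq_square power3_eq_cube mult_ac)
      also have "\<dots> \<le> 32 * (C * K ^ 3 * ?y * \<bar>p k\<bar>)"
        using pos C_ge by (intro mult_right_mono) auto
      finally show ?thesis by (simp add: A_def mult_ac)
    next
      case False
      have q: "X k \<le> 2 * K * \<bar>q k\<bar>" using X_le[of k] False by (simp add: algebra_simps)
      \<comment> \<open>The vector \<open>j\<close> lies in the plane that it spans with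
        \<open>Suc j\<close>. By \<open>p_small\<close>, the term with \<open>p j\<close> takes at
        most half of the left side, which leaves a lower bound for \<open>lp\<close>.\<close>
      have "l j * pq j (Suc j) = p j * lq j (Suc j) - q j * lp j (Suc j)"
        unfolding lp_def lq_def pq_def by algebra
      hence "\<bar>l j\<bar> * ?W \<le> \<bar>p j\<bar> * \<bar>lq j (Suc j)\<bar> + \<bar>q j\<bar> * \<bar>lp j (Suc j)\<bar>"
        by (metis abs_mult abs_triangle_ineq4)
      also have "\<dots> \<le> \<bar>p j\<bar> * (2 * K * \<bar>l j\<bar> * ?y) + (K * ?x) * \<bar>lp j (Suc j)\<bar>"
        using minor_le(1) q_le by (intro add_mono mult_left_mono mult_right_mono) auto
      also have "\<dots> = \<bar>l j\<bar> * (4 * K * ?y * \<bar>p j\<bar>) / 2 + K * ?x * \<bar>lp j (Suc j)\<bar>" by simp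
      also have "\<dots> \<le> \<bar>l j\<bar> * ?W / 2 + K * ?x * \<bar>lp j (Suc j)\<bar>"
        using elim(2) ind by (intro add_mono divide_right_mono mult_left_mono order_refl) auto
      finally have lp: "\<bar>l j\<bar> * ?W \<le> 2 * K * ?x * \<bar>lp j (Suc j)\<bar>" by simp
      have "q k * lp j (Suc j) = p k * lq j (Suc j) - l k * pq j (Suc j)"
        using det unfolding det3_def by simp
      hence "\<bar>q k\<bar> * \<bar>lp j (Suc j)\<bar> \<le> \<bar>p k\<bar> * \<bar>lq j (Suc j)\<bar> + \<bar>l k\<bar> * ?W"
        by (metis abs_mult abs_triangle_ineq4)
      also have "\<dots> \<le> \<bar>p k\<bar> * (2 * K * \<bar>l j\<bar> * ?y) + \<bar>l j\<bar> * ?W"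
        using minor_le(1) l_antimono[of j k] k by (intro add_mono mult_left_mono mult_right_mono) auto
      finally have up: "\<bar>q k\<bar> * \<bar>lp j (Suc j)\<bar> \<le> \<bar>p k\<bar> * (2 * K * \<bar>l j\<bar> * ?y) + \<bar>l j\<bar> * ?W" .
      have "X k * (\<bar>l j\<bar> * ?W) \<le> (2 * K * \<bar>q k\<bar>) * (2 * K * ?x * \<bar>lp j (Suc j)\<bar>)"
        by (rule mult_mono) (use lp q pos in auto)
      also have "\<dots> = 4 * K\<^sup>2 * ?x * (\<bar>q k\<bar> * \<bar>lp j (Suc j)\<bar>)" by (simp add: power2_eq_square)
      also have "\<dots> \<le> 4 * K\<^sup>2 * ?x * (\<bar>p k\<bar> * (2 * K * \<bar>l j\<bar> * ?y) + \<bar>l j\<bar> * ?W)"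
        using up pos by (intro mult_left_mono) auto
      \<comment> \<open>The coefficient \<open>4 * K\<^sup>2\<close> is written as
        \<open>16 * K\<^sup>2 / 4\<close> so that \<open>ratio_ge\<close> turns the last term into a
        quarter of \<open>X k * \<bar>pq j (Suc j)\<bar>\<close>, to be absorbed on the
        left.\<close>
      also have "\<dots> = \<bar>l j\<bar> * (8 * K ^ 3 * ?x * ?y * \<bar>p k\<bar> + 16 * K\<^sup>2 * ?x / 4 * ?W)"
        by (simp add: power2_eq_square power3_eq_cube algebra_simps)
      also have "\<dots> \<le> \<bar>l j\<bar> * (8 * K ^ 3 * ?x * ?y * \<bar>p k\<bar> + X k / 4 * ?W)"
        using elim(3) ind yk by (intro mult_left_mono add_mono mult_right_mono divide_right_mono order_refl) auto
      finally have "\<bar>l j\<bar> * (X k * ?W) \<le> \<bar>l j\<bar> * (8 * K ^ 3 * ?x * ?y * \<bar>p k\<bar> + X k / 4 * ?W)"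
        by (simp add: mult_ac)
      hence "X k * ?W \<le> 8 * K ^ 3 * ?x * ?y * \<bar>p k\<bar> + X k / 4 * ?W"
        using l_nonzero[of j] by simp
      moreover have "0 \<le> K ^ 3 * ?x * ?y * \<bar>p k\<bar>" using pos by simp
      ultimately have "X k * ?W \<le> 16 * K ^ 3 * ?x * ?y * \<bar>p k\<bar>" by simp
      hence 1: "2 * C * (X k * ?W) \<le> 2 * C * (16 * K ^ 3 * ?x * ?y * \<bar>p k\<bar>)"
        using C_ge by (intro mult_left_mono) auto
      have "X k * ?x powr \<gamma> \<le> X k * (2 * C * ?W)"
        using elim(4) ind pos by (intro mult_left_mono) auto
      also have "\<dots> = 2 * C * (X k * ?W)" by simp
      also note 1
      also have "2 * C * (16 * K ^ 3 * ?x * ?y * \<bar>p k\<bar>) = A * ?y * \<bar>p k\<bar> * ?x" by (simp add: A_def)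
      finally have "X k * ?x powr (\<gamma> - 1) * ?x \<le> A * ?y * \<bar>p k\<bar> * ?x"
        using powr_add[of ?x "\<gamma> - 1" 1] pos by (simp add: mult_ac)
      thus ?thesis using pos by simp
    qed
  qed
qed

text \<open>Jarnik's inequality \<open>growth\<close> says that the excess is nonnegative at independent points, whereas
  \<open>excess_step\<close> makes it drop by at least 1 from one independent point to the next.\<close>

definition excess :: "nat \<Rightarrow> real" where
  "excess j = ln (X (Suc j)) - (\<gamma> - 1) * ln (X j) + ln B"

lemma excess_nonneg: "\<forall>\<^sub>F j in sequentially. independent j \<longrightarrow> 0 \<le> excess j"
  using growth
proof eventually_elim
  case (elim j)
  show ?case
  proof
    assume "independent j"
    hence "ln (X j powr (\<gamma> - 1)) \<le> ln (B * X (Suc j))"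
      using elim X_pos[of j] X_pos[of "Suc j"] B_ge by (subst ln_le_cancel_iff) simp_all
    thus "0 \<le> excess j"
      using X_pos[of j] X_pos[of "Suc j"] B_ge by (simp add: excess_def ln_powr ln_mult)
  qed
qed

text \<open>Logarithms of \<open>p_next_ge\<close>, with \<open>p k\<close> bounded above by
  \<open>p_le_l\<close> and \<open>l_le\<close>. Since
  \<open>\<gamma>\<^sup>2 - \<gamma> = \<gamma> * (\<gamma> - 1)\<close>, the terms in
  \<open>k\<close> combine to \<gamma> times its excess, and \<epsilon> leaves a surplus.\<close>

lemma excess_step:
  "\<forall>\<^sub>F j in sequentially. \<forall>k. independent j \<longrightarrow> j < k \<longrightarrow> det3 k j (Suc j) = 0 \<longrightarrow>
     \<gamma> * excess k + \<epsilon> * ln (X k) \<le> excess j + ln (A * K * C) + (\<gamma> - 1) * ln B"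
  using p_next_ge
proof eventually_elim
  case (elim j)
  show ?case
  proof (intro allI impI)
    fix k assume asm: "independent j" "j < k" "det3 k j (Suc j) = 0"
    let ?e = "\<gamma>\<^sup>2 - \<gamma> + 1 - \<epsilon>"
    have pos: "X j > 0" "X (Suc j) > 0" "X k > 0" "X (Suc k) > 0" "A > 0" "B > 0" "C > 0" "K > 0"
      using X_pos A_ge B_ge C_ge K_ge by auto
    have "X k * X j powr (\<gamma> - 1) \<le> A * X (Suc j) * \<bar>p k\<bar>" using elim asm by blast
    also have "\<dots> \<le> A * X (Suc j) * (K * (C * X (Suc k) powr - \<gamma>) * X k powr ?e)"
      using pos l_le[of k]
      by (intro mult_left_mono order_trans[OF p_le_l] mult_right_mono) auto
    finally have "ln (X k * X j powr (\<gamma> - 1)) \<le> ln (A * K * C * X (Suc j) * X (Suc k) powr - \<gamma> * X k powr ?e)"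
      using pos by (subst ln_le_cancel_iff) (auto simp: mult_ac)
    hence "ln (X k) + (\<gamma> - 1) * ln (X j) \<le> ln (A * K * C) + ln (X (Suc j)) - \<gamma> * ln (X (Suc k)) + ?e * ln (X k)"
      using pos by (simp add: ln_mult ln_powr)
    thus "\<gamma> * excess k + \<epsilon> * ln (X k) \<le> excess j + ln (A * K * C) + (\<gamma> - 1) * ln B"
      by (simp add: excess_def algebra_simps power2_eq_square)
  qed
qed

lemma contradiction: False
proof -
  define D where "D = ln (A * K * C) + (\<gamma> - 1) * ln B"
  have "filterlim (\<lambda>j. ln (X j)) at_top sequentially"
    by (rule filterlim_compose[OF ln_at_top X_lim])
  \<comment> \<open>From here on the surplus exceeds the constant \<open>D\<close> by 1, which is
    the drop of the excess per step.\<close>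
  hence "\<forall>\<^sub>F j in sequentially. (D + 1) / \<epsilon> \<le> ln (X j)" by (simp add: filterlim_at_top)
  with excess_nonneg excess_step
  have "\<forall>\<^sub>F j in sequentially. (independent j \<longrightarrow> 0 \<le> excess j) \<and>
      (\<forall>k. independent j \<longrightarrow> j < k \<longrightarrow> det3 k j (Suc j) = 0 \<longrightarrow>
        \<gamma> * excess k + \<epsilon> * ln (X k) \<le> excess j + D) \<and> D + 1 \<le> \<epsilon> * ln (X j)"
    by eventually_elim (use \<epsilon>_pos in \<open>auto simp: D_def field_simps\<close>)
  then obtain N where N: "\<And>j. N \<le> j \<Longrightarrow> independent j \<Longrightarrow> 0 \<le> excess j"
    "\<And>j k. N \<le> j \<Longrightarrow> independent j \<Longrightarrow> j < k \<Longrightarrow> det3 k j (Suc j) = 0 \<Longrightarrow>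
        \<gamma> * excess k + \<epsilon> * ln (X k) \<le> excess j + D"
    "\<And>j. N \<le> j \<Longrightarrow> D + 1 \<le> \<epsilon> * ln (X j)"
    unfolding eventually_sequentially by blast
  obtain j0 where j0: "N \<le> j0" "independent j0" using infinitely_many_independent by blast
  have "\<exists>j\<ge>N. independent j \<and> excess j \<le> excess j0 - real n" for n
  proof (induction n)
    case 0
    show ?case using j0 by auto
  next
    case (Suc n)
    then obtain j where j: "N \<le> j" "independent j" "excess j \<le> excess j0 - real n" by blast
    obtain k where k: "j < k" "independent k" "det3 k j (Suc j) = 0"
      using next_independent[OF j(2)] .
    have "\<gamma> * excess k + \<epsilon> * ln (X k) \<le> excess j + D" using N(2) j k by blast
    moreover have "D + 1 \<le> \<epsilon> * ln (X k)" "0 \<le> excess k" using N(1,3) j k by auto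
    moreover from this have "1 * excess k \<le> \<gamma> * excess k" using \<gamma>_ge by (intro mult_right_mono) auto
    ultimately have "excess k \<le> excess j0 - real (Suc n)" using j(3) by simp
    thus ?case using k j by (intro exI[of _ k]) auto
  qed
  moreover obtain n :: nat where "excess j0 < real n" using reals_Archimedean2 by blast
  ultimately obtain j where "N \<le> j" "independent j" "excess j < 0" by (metis diff_less_0_iff_less order_le_less_trans)
  thus False using N(1)[of j] by simp
qed

end

section \<open>The sequence of minimal points\<close>

text \<open>The maximum norm is the naive height of the polynomial with these coefficients; passing
  to it from the Euclidean length changes only constants.\<close>

definition height :: "int \<times> int \<times> int \<Rightarrow> int" where
  "height = (\<lambda>(a, b, c). max \<bar>a\<bar> (max \<bar>b\<bar> \<bar>c\<bar>))"

definition form :: "real \<Rightarrow> int \<times> int \<times> int \<Rightarrow> real" where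
  "form \<theta> = (\<lambda>(a, b, c). a + b * \<theta> + c * \<theta>\<^sup>2)"

definition form' :: "real \<Rightarrow> int \<times> int \<times> int \<Rightarrow> real" where
  "form' \<theta> = (\<lambda>(a, b, c). b + 2 * \<theta> * c)"

lemma height_ge: "\<bar>a\<bar> \<le> height (a, b, c)" "\<bar>b\<bar> \<le> height (a, b, c)" "\<bar>c\<bar> \<le> height (a, b, c)"
  by (simp_all add: height_def)

lemma height_ge_1: "z \<noteq> (0, 0, 0) \<Longrightarrow> 1 \<le> height z"
  by (cases z) (auto simp: height_def max_def)

lemma finite_height_le: "finite {z. height z \<le> n}"
proof (rule finite_subset)
  show "{z. height z \<le> n} \<subseteq> {-n..n} \<times> {-n..n} \<times> {-n..n}"
    by (auto simp: height_def)
qed auto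

lemma exists_smaller_form:
  assumes unif: "\<And>t :: real. 1 \<le> t \<Longrightarrow> \<exists>z. z \<noteq> (0, 0, 0) \<and> real_of_int (height z) \<le> t \<and> \<bar>form \<theta> z\<bar> \<le> C * t powr - \<gamma>"
    and "0 < \<gamma>" "0 < \<delta>"
  obtains z where "z \<noteq> (0, 0, 0)" "\<bar>form \<theta> z\<bar> < \<delta>"
proof -
  have "((\<lambda>t. C * t powr - \<gamma>) \<longlongrightarrow> C * 0) at_top"
    using assms(2) by (intro tendsto_intros tendsto_neg_powr filterlim_ident) auto
  hence "\<forall>\<^sub>F t in at_top. C * t powr - \<gamma> < \<delta>" using assms(3) by (auto dest: order_tendstoD)
  with eventually_ge_at_top[of 1] have "\<forall>\<^sub>F t in at_top. 1 \<le> t \<and> C * t powr - \<gamma> < \<delta>"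
    by eventually_elim auto
  then obtain t where "1 \<le> t" "C * t powr - \<gamma> < \<delta>" using eventually_happens by force
  moreover from this obtain z where "z \<noteq> (0, 0, 0)" "\<bar>form \<theta> z\<bar> \<le> C * t powr - \<gamma>"
    using unif[of t] by blast
  ultimately show ?thesis using that[of z] by linarith
qed

text \<open>The minimal points of the form are enumerated and shown to satisfy
  \<open>approximation_sequence\<close>, which is contradictory.\<close>

lemma derivative_not_uniformly_small:
  assumes nz: "\<And>z. z \<noteq> (0, 0, 0) \<Longrightarrow> form \<theta> z \<noteq> 0"
    and unif: "\<And>t :: real. 1 \<le> t \<Longrightarrow> \<exists>z. z \<noteq> (0, 0, 0) \<and> real_of_int (height z) \<le> t \<and> \<bar>form \<theta> z\<bar> \<le> C * t powr - \<gamma>"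
    and \<gamma>: "2 \<le> \<gamma>" and \<epsilon>: "0 < \<epsilon>" "\<epsilon> \<le> 1/2"
    and der: "\<And>z. z \<noteq> (0, 0, 0) \<Longrightarrow>
      \<bar>form' \<theta> z\<bar> \<le> K * \<bar>form \<theta> z\<bar> * height z powr (\<gamma>\<^sup>2 - \<gamma> + 1 - \<epsilon>)"
  shows False
proof -
  have ex: "\<exists>y. y \<noteq> (0, 0, 0) \<and> \<bar>form \<theta> y\<bar> < \<bar>form \<theta> z\<bar> \<and>
      (\<forall>w. w \<noteq> (0, 0, 0) \<longrightarrow> \<bar>form \<theta> w\<bar> < \<bar>form \<theta> z\<bar> \<longrightarrow> height y \<le> height w)"
    if z: "z \<noteq> (0, 0, 0)" for z
  proof -
    obtain w where "w \<noteq> (0, 0, 0)" "\<bar>form \<theta> w\<bar> < \<bar>form \<theta> z\<bar>"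
      using exists_smaller_form[OF unif, of "\<bar>form \<theta> z\<bar>"] nz[OF z] \<gamma> by auto
    then obtain y where y: "y \<noteq> (0, 0, 0) \<and> \<bar>form \<theta> y\<bar> < \<bar>form \<theta> z\<bar>"
      "\<forall>w. w \<noteq> (0, 0, 0) \<and> \<bar>form \<theta> w\<bar> < \<bar>form \<theta> z\<bar> \<longrightarrow> nat (height y) \<le> nat (height w)"
      using ex_has_least_nat[of "\<lambda>w. w \<noteq> (0, 0, 0) \<and> \<bar>form \<theta> w\<bar> < \<bar>form \<theta> z\<bar>" w "\<lambda>w. nat (height w)"]
      by metis
    have "height y \<le> height w" if w: "w \<noteq> (0, 0, 0)" "\<bar>form \<theta> w\<bar> < \<bar>form \<theta> z\<bar>" for w
    proof -
      have "nat (height y) \<le> nat (height w)" using y(2) w by blast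
      thus ?thesis using height_ge_1[OF w(1)] by linarith
    qed
    thus ?thesis using y(1) by blast
  qed
  \<comment> \<open>The next minimal point: a vector of least height among those with strictly
    smaller form value. Form values thus decrease strictly, while heights may repeat.\<close>
  define nx where "nx z = (SOME y. y \<noteq> (0, 0, 0) \<and> \<bar>form \<theta> y\<bar> < \<bar>form \<theta> z\<bar> \<and>
      (\<forall>w. w \<noteq> (0, 0, 0) \<longrightarrow> \<bar>form \<theta> w\<bar> < \<bar>form \<theta> z\<bar> \<longrightarrow> height y \<le> height w))" for z
  have nx: "nx z \<noteq> (0, 0, 0)" "\<bar>form \<theta> (nx z)\<bar> < \<bar>form \<theta> z\<bar>"
    "w \<noteq> (0, 0, 0) \<Longrightarrow> \<bar>form \<theta> w\<bar> < \<bar>form \<theta> z\<bar> \<Longrightarrow> height (nx z) \<le> height w"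
    if "z \<noteq> (0, 0, 0)" for z w
    using someI_ex[OF ex[OF that]] unfolding nx_def by blast+
  define y where "y j = (nx ^^ j) (1, 0, 0)" for j
  have y_Suc: "y (Suc j) = nx (y j)" for j by (simp add: y_def)
  have y_nz: "y j \<noteq> (0, 0, 0)" for j
  proof (induction j)
    case (Suc j)
    thus ?case using nx(1) y_Suc by metis
  qed (simp add: y_def)
  have y_less: "\<bar>form \<theta> (y (Suc j))\<bar> < \<bar>form \<theta> (y j)\<bar>" for j
    using nx(2) y_nz y_Suc by metis
  have y_min: "\<bar>form \<theta> (y j)\<bar> \<le> \<bar>form \<theta> w\<bar>" if "w \<noteq> (0, 0, 0)" "height w < height (y (Suc j))" for j w
    using nx(3)[OF y_nz[of j] that(1)] that(2) y_Suc[of j] by fastforce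
  \<comment> \<open>The start \<open>(1, 0, 0)\<close> has form value 1; dropping it ensures
    \<open>\<bar>l j\<bar> < 1\<close> for every \<open>j\<close>.\<close>
  define z where "z j = y (Suc j)" for j
  define l where "l j = form \<theta> (z j)" for j
  define p where "p j = form' \<theta> (z j)" for j
  define q where "q j = real_of_int (snd (snd (z j)))" for j
  define X where "X j = real_of_int (height (z j))" for j
  have z_nz: "z j \<noteq> (0, 0, 0)" for j by (simp add: z_def y_nz)
  have l_less: "\<bar>l (Suc j)\<bar> < \<bar>l j\<bar>" for j by (simp add: l_def z_def y_less)
  have l_less_1: "\<bar>l j\<bar> < 1" for j
  proof (induction j)
    case 0
    show ?case using y_less[of 0] by (simp add: l_def z_def) (simp add: y_def form_def)
  next
    case (Suc j)
    thus ?case using l_less[of j] by simp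
  qed
  have X_ge: "1 \<le> X j" for j using height_ge_1[OF z_nz[of j]] by (simp add: X_def)
  have X_Suc: "X j \<le> X (Suc j)" for j
  proof -
    have "\<bar>form \<theta> (y (Suc (Suc j)))\<bar> < \<bar>form \<theta> (y j)\<bar>" using y_less less_trans by blast
    hence "height (y (Suc j)) \<le> height (y (Suc (Suc j)))" using nx(3) y_nz y_Suc by metis
    thus ?thesis by (simp add: X_def z_def)
  qed
  have X_mono: "i \<le> j \<Longrightarrow> X i \<le> X j" for i j using X_Suc by (rule lift_Suc_mono_le)
  have l_strict: "i < j \<Longrightarrow> \<bar>l j\<bar> < \<bar>l i\<bar>" for i j
    using lift_Suc_mono_less[of "\<lambda>j. - \<bar>l j\<bar>" i j] l_less by simp
  have inj: "inj z"
  proof (rule injI, rule ccontr)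
    fix i j assume "z i = z j" "i \<noteq> j"
    thus False using l_strict[of i j] l_strict[of j i] by (cases i j rule: linorder_cases) (auto simp: l_def)
  qed
  have X_lim: "filterlim X at_top sequentially"
    unfolding filterlim_at_top
  proof
    fix B :: real
    have "\<exists>j. B \<le> X j"
    proof (rule ccontr)
      assume "\<nexists>j. B \<le> X j"
      hence "real_of_int (height (z j)) \<le> B" for j by (auto simp: not_le X_def less_imp_le)
      hence "height (z j) \<le> \<lfloor>B\<rfloor>" for j by (simp add: le_floor_iff)
      hence "range z \<subseteq> {z. height z \<le> \<lfloor>B\<rfloor>}" by auto
      hence "finite (range z)" using finite_height_le finite_subset by blast
      thus False using inj range_inj_infinite by blast
    qed
    then obtain j where "B \<le> X j" ..
    thus "\<forall>\<^sub>F i in sequentially. B \<le> X i"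
      unfolding eventually_sequentially using X_mono order_trans by blast
  qed
  \<comment> \<open>The factor \<open>2 powr \<gamma>\<close> arises because the uniform bound is
    applied at \<open>X (Suc j) / 2\<close>, safely below the next height. A height below 2 is 1,
    and there \<open>1 \<le> C'\<close> suffices.\<close>
  define C' where "C' = max 1 C * 2 powr \<gamma>"
  \<comment> \<open>Large enough for \<open>K\<close> of either sign, for \<open>p\<close> in terms
    of the height, and for recovering the integer coordinates from \<open>p\<close> and
    \<open>q\<close>.\<close>
  define K' where "K' = max K 0 + 1 + 2 * \<bar>\<theta>\<bar> + 3 * \<theta>\<^sup>2"
  have two: "1 \<le> (2 :: real) powr \<gamma>" using \<gamma> by (intro ge_one_powr_ge_zero) auto
  have C'_ge: "1 \<le> C'" using two mult_mono[of 1 "max 1 C" 1 "2 powr \<gamma>"] by (simp add: C'_def)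
  have l_le: "\<bar>l j\<bar> \<le> C' * X (Suc j) powr - \<gamma>" for j
  proof (cases "2 \<le> X (Suc j)")
    case True
    then obtain w where w: "w \<noteq> (0, 0, 0)" "height w \<le> X (Suc j) / 2"
      "\<bar>form \<theta> w\<bar> \<le> C * (X (Suc j) / 2) powr - \<gamma>"
      using unif[of "X (Suc j) / 2"] by auto
    have "real_of_int (height w) < X (Suc j)" using w(2) True by simp
    hence "\<bar>form \<theta> (y (Suc j))\<bar> \<le> \<bar>form \<theta> w\<bar>" using w(1) by (intro y_min) (simp_all add: X_def z_def)
    hence "\<bar>l j\<bar> \<le> C * (X (Suc j) / 2) powr - \<gamma>" using w(3) by (simp add: l_def z_def)
    also have "\<dots> \<le> max 1 C * (X (Suc j) / 2) powr - \<gamma>" by (intro mult_right_mono) auto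
    also have "\<dots> = C' * X (Suc j) powr - \<gamma>"
      using True by (simp add: C'_def powr_divide powr_minus field_simps)
    finally show ?thesis .
  next
    case False
    hence "X (Suc j) = 1" using X_ge[of "Suc j"] by (simp add: X_def)
    thus ?thesis using l_less_1[of j] C'_ge by simp
  qed
  interpret approximation_sequence l p q X \<gamma> \<epsilon> C' K'
  proof
    show "1 \<le> K'" by (simp add: K'_def)
    fix j
    obtain a b c where zj: "z j = (a, b, c)" by (cases "z j")
    have abc: "\<bar>real_of_int a\<bar> \<le> X j" "\<bar>real_of_int b\<bar> \<le> X j" "\<bar>real_of_int c\<bar> \<le> X j"
      by (simp_all add: X_def zj height_def flip: of_int_abs)
    have pj: "p j = b + 2 * \<theta> * c" and qj: "q j = c" and lj: "l j = a + b * \<theta> + c * \<theta>\<^sup>2"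
      by (simp_all add: p_def q_def l_def zj form'_def form_def)
    show "l j \<noteq> 0" using nz z_nz by (simp add: l_def)
    show "\<bar>p j\<bar> \<le> K' * \<bar>l j\<bar> * X j powr (\<gamma>\<^sup>2 - \<gamma> + 1 - \<epsilon>)"
    proof -
      have "K \<le> K'" using zero_le_power2[of \<theta>] abs_ge_zero[of \<theta>] unfolding K'_def by linarith
      hence "K * \<bar>l j\<bar> * X j powr (\<gamma>\<^sup>2 - \<gamma> + 1 - \<epsilon>) \<le> K' * \<bar>l j\<bar> * X j powr (\<gamma>\<^sup>2 - \<gamma> + 1 - \<epsilon>)"
        by (intro mult_right_mono) auto
      thus ?thesis using der[OF z_nz[of j]] by (simp add: p_def l_def X_def)
    qed
    have "\<bar>p j\<bar> \<le> \<bar>real_of_int b\<bar> + 2 * \<bar>\<theta>\<bar> * \<bar>real_of_int c\<bar>"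
      unfolding pj by (rule order_trans[OF abs_triangle_ineq]) (simp add: abs_mult)
    also have "\<dots> \<le> X j + 2 * \<bar>\<theta>\<bar> * X j" using abc by (intro add_mono mult_left_mono) auto
    also have "\<dots> \<le> K' * X j"
    proof -
      have "1 + 2 * \<bar>\<theta>\<bar> \<le> K'" using zero_le_power2[of \<theta>] unfolding K'_def by linarith
      hence "(1 + 2 * \<bar>\<theta>\<bar>) * X j \<le> K' * X j" using X_ge[of j] by (intro mult_right_mono) auto
      thus ?thesis by (simp add: distrib_right)
    qed
    finally show "\<bar>p j\<bar> \<le> K' * X j" .
    have "1 * X j \<le> K' * X j" using X_ge[of j] \<open>1 \<le> K'\<close> by (intro mult_right_mono) auto
    thus "\<bar>q j\<bar> \<le> K' * X j" using abc by (simp add: qj)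
    \<comment> \<open>If \<open>b\<close> or \<open>c\<close> is nonzero, the right side is at least
      1; otherwise \<open>a\<close> would be an integer of absolute value below 1, and the vector
      would vanish.\<close>
    have pq1: "\<bar>l j\<bar> \<le> \<bar>p j\<bar> + \<bar>q j\<bar>"
    proof (cases "c = 0")
      case True
      have "b \<noteq> 0"
      proof
        assume "b = 0"
        hence "\<bar>real_of_int a\<bar> < 1" using l_less_1[of j] True by (simp add: lj)
        hence "a = 0" by linarith
        thus False using z_nz[of j] True \<open>b = 0\<close> by (simp add: zj)
      qed
      hence "1 \<le> \<bar>real_of_int b\<bar>" by linarith
      thus ?thesis using l_less_1[of j] True by (simp add: pj qj)
    next
      case False
      hence "1 \<le> \<bar>real_of_int c\<bar>" by linarith
      thus ?thesis using l_less_1[of j] by (simp add: qj)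
    qed
    have "b = p j - 2 * \<theta> * q j" by (simp add: pj qj)
    hence "\<bar>real_of_int b\<bar> \<le> \<bar>p j\<bar> + \<bar>2 * \<theta> * q j\<bar>" by (metis abs_triangle_ineq4)
    hence b: "\<bar>real_of_int b\<bar> \<le> \<bar>p j\<bar> + 2 * \<bar>\<theta>\<bar> * \<bar>q j\<bar>" by (simp add: abs_mult)
    have "a = l j - (p j * \<theta> - \<theta>\<^sup>2 * q j)" by (simp add: lj pj qj algebra_simps power2_eq_square)
    hence "\<bar>real_of_int a\<bar> \<le> \<bar>l j\<bar> + \<bar>p j * \<theta> - \<theta>\<^sup>2 * q j\<bar>" by (metis abs_triangle_ineq4)
    also have "\<bar>p j * \<theta> - \<theta>\<^sup>2 * q j\<bar> \<le> \<bar>\<theta>\<bar> * \<bar>p j\<bar> + \<theta>\<^sup>2 * \<bar>q j\<bar>"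
      by (rule order_trans[OF abs_triangle_ineq4]) (simp add: abs_mult)
    finally have a: "\<bar>real_of_int a\<bar> \<le> \<bar>p j\<bar> + \<bar>q j\<bar> + \<bar>\<theta>\<bar> * \<bar>p j\<bar> + \<theta>\<^sup>2 * \<bar>q j\<bar>"
      using pq1 by linarith
    have nn: "0 \<le> \<bar>\<theta>\<bar> * \<bar>p j\<bar>" "0 \<le> \<bar>\<theta>\<bar> * \<bar>q j\<bar>" "0 \<le> \<theta>\<^sup>2 * \<bar>p j\<bar>" "0 \<le> \<theta>\<^sup>2 * \<bar>q j\<bar>"
      "0 \<le> max K 0 * (\<bar>p j\<bar> + \<bar>q j\<bar>)" by auto
    have "K' * (\<bar>p j\<bar> + \<bar>q j\<bar>) = max K 0 * (\<bar>p j\<bar> + \<bar>q j\<bar>) + \<bar>p j\<bar> + \<bar>q j\<bar>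
        + 2 * (\<bar>\<theta>\<bar> * \<bar>p j\<bar>) + 2 * (\<bar>\<theta>\<bar> * \<bar>q j\<bar>) + 3 * (\<theta>\<^sup>2 * \<bar>p j\<bar>) + 3 * (\<theta>\<^sup>2 * \<bar>q j\<bar>)"
      by (simp add: K'_def algebra_simps)
    moreover have "A \<le> R" if "A \<le> P + Q + tP + sQ \<or> A \<le> P + 2 * tQ \<or> A \<le> Q" "0 \<le> P" "0 \<le> Q"
      "0 \<le> tP" "0 \<le> tQ" "0 \<le> sP" "0 \<le> sQ" "0 \<le> kPQ"
      "R = kPQ + P + Q + 2 * tP + 2 * tQ + 3 * sP + 3 * sQ" for A R P Q tP tQ sP sQ kPQ :: real
      using that by linarith
    note this[OF _ abs_ge_zero abs_ge_zero nn]
    ultimately have *: "A \<le> K' * (\<bar>p j\<bar> + \<bar>q j\<bar>)"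
      if "A \<le> \<bar>p j\<bar> + \<bar>q j\<bar> + \<bar>\<theta>\<bar> * \<bar>p j\<bar> + \<theta>\<^sup>2 * \<bar>q j\<bar> \<or> A \<le> \<bar>p j\<bar> + 2 * (\<bar>\<theta>\<bar> * \<bar>q j\<bar>) \<or> A \<le> \<bar>q j\<bar>" for A
      using that by blast
    have "\<bar>real_of_int a\<bar> \<le> K' * (\<bar>p j\<bar> + \<bar>q j\<bar>)" using a by (intro * disjI1)
    moreover have "\<bar>real_of_int b\<bar> \<le> K' * (\<bar>p j\<bar> + \<bar>q j\<bar>)"
      using b unfolding mult.assoc by (intro * disjI2[OF disjI1])
    moreover have "\<bar>real_of_int c\<bar> \<le> K' * (\<bar>p j\<bar> + \<bar>q j\<bar>)" using qj by (intro * disjI2) simp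
    moreover have "X j \<in> {\<bar>real_of_int a\<bar>, \<bar>real_of_int b\<bar>, \<bar>real_of_int c\<bar>}"
      by (auto simp: X_def zj height_def max_def)
    ultimately show "X j \<le> K' * (\<bar>p j\<bar> + \<bar>q j\<bar>)" by auto
    obtain a' b' c' where zj': "z (Suc j) = (a', b', c')" by (cases "z (Suc j)")
    have pj': "p (Suc j) = b' + 2 * \<theta> * c'" and qj': "q (Suc j) = c'"
      and lj': "l (Suc j) = a' + b' * \<theta> + c' * \<theta>\<^sup>2"
      by (simp_all add: p_def q_def l_def zj' form'_def form_def)
    define u v w where "u = a * b' - a' * b" and "v = a * c' - a' * c" and "w = b * c' - b' * c"
    \<comment> \<open>A unitriangular change from the integer minors \<open>u\<close>,
      \<open>v\<close>, \<open>w\<close>: if the sum of absolute values is below 1, then first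
      \<open>w\<close>, then \<open>v\<close>, then \<open>u\<close> vanishes.\<close>
    have minors: "l j * p (Suc j) - l (Suc j) * p j = u + 2 * \<theta> * v + \<theta>\<^sup>2 * w"
      "l j * q (Suc j) - l (Suc j) * q j = v + \<theta> * w"
      "p j * q (Suc j) - p (Suc j) * q j = w"
      unfolding lj lj' pj pj' qj qj' u_def v_def w_def
      by (simp_all add: algebra_simps power2_eq_square)
    show "1 \<le> \<bar>l j * p (Suc j) - l (Suc j) * p j\<bar> + \<bar>l j * q (Suc j) - l (Suc j) * q j\<bar>
      + \<bar>p j * q (Suc j) - p (Suc j) * q j\<bar>"
    proof (rule ccontr)
      assume small: "\<not> ?thesis"
      hence "\<bar>real_of_int w\<bar> < 1" unfolding minors by linarith
      hence w: "w = 0" by linarith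
      hence "\<bar>real_of_int v\<bar> < 1" using small unfolding minors by simp
      hence v: "v = 0" by linarith
      hence "\<bar>real_of_int u\<bar> < 1" using w small unfolding minors by simp
      hence u: "u = 0" by linarith
      \<comment> \<open>With all minors zero, consecutive vectors are proportional in the ratio of
        their form values, so the height would decrease strictly together with the form.\<close>
      have "l j * a' - l (Suc j) * a = - \<theta> * u - \<theta>\<^sup>2 * v" "l j * b' - l (Suc j) * b = u - \<theta>\<^sup>2 * w"
        "l j * c' - l (Suc j) * c = v + \<theta> * w"
        unfolding lj lj' u_def v_def w_def by (simp_all add: algebra_simps)
      hence "l j * a' = l (Suc j) * a" "l j * b' = l (Suc j) * b" "l j * c' = l (Suc j) * c"
        using u v w by simp_all
      hence "\<bar>l j\<bar> * \<bar>a'\<bar> = \<bar>l (Suc j)\<bar> * \<bar>a\<bar>" "\<bar>l j\<bar> * \<bar>b'\<bar> = \<bar>l (Suc j)\<bar> * \<bar>b\<bar>"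
        "\<bar>l j\<bar> * \<bar>c'\<bar> = \<bar>l (Suc j)\<bar> * \<bar>c\<bar>" by (metis abs_mult of_int_abs)+
      moreover have "X (Suc j) \<in> {\<bar>real_of_int a'\<bar>, \<bar>real_of_int b'\<bar>, \<bar>real_of_int c'\<bar>}"
        by (auto simp: X_def zj' height_def max_def)
      ultimately have "\<bar>l j\<bar> * X (Suc j) \<le> \<bar>l (Suc j)\<bar> * X j"
        using abc by (auto intro!: mult_left_mono)
      also have "\<dots> < \<bar>l j\<bar> * X j" using l_less[of j] X_ge[of j] by (intro mult_strict_right_mono) auto
      also have "\<dots> \<le> \<bar>l j\<bar> * X (Suc j)" using X_Suc by (intro mult_left_mono) auto
      finally show False by simp
    qed
  next
    fix i j k
    obtain a b c where z1: "z i = (a, b, c)" by (cases "z i")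
    obtain a' b' c' where z2: "z j = (a', b', c')" by (cases "z j")
    obtain a'' b'' c'' where z3: "z k = (a'', b'', c'')" by (cases "z k")
    have "l i * (p j * q k - p k * q j) - p i * (l j * q k - l k * q j) + q i * (l j * p k - l k * p j)
      = real_of_int (a * (b' * c'' - b'' * c') - b * (a' * c'' - a'' * c') + c * (a' * b'' - a'' * b'))"
      unfolding l_def p_def q_def z1 z2 z3 form_def form'_def
      by (simp add: algebra_simps power2_eq_square)
    thus "l i * (p j * q k - p k * q j) - p i * (l j * q k - l k * q j) + q i * (l j * p k - l k * p j) \<in> \<int>"
      by simp
  qed (use \<gamma> \<epsilon> C'_ge X_ge X_Suc X_lim l_le less_imp_le[OF l_less] in auto)
  show False by (rule contradiction)
qed

section \<open>Roots of integer polynomials of degree at most 2\<close>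

definition triple_poly :: "int \<times> int \<times> int \<Rightarrow> int poly" where
  "triple_poly = (\<lambda>(a, b, c). [:a, b, c:])"

lemma map_poly_of_int_mult:
  "map_poly (of_int :: int \<Rightarrow> 'a::field_char_0) (p * q) = map_poly of_int p * map_poly of_int q"
  by (simp add: poly_eq_iff coeff_map_poly coeff_mult)

text \<open>The remainder of pseudo-division has the root \<open>x\<close> and smaller degree, so it
  vanishes. As \<open>q\<close> is primitive, Gauss's lemma shows that the multiplier
  \<open>c\<close> divides the quotient.\<close>

lemma canonical_poly_dvd:
  fixes x :: "'a::field_char_0"
  assumes q: "is_canonical_poly q x" and root: "poly (map_poly of_int p) x = 0"
  shows "q dvd p"
proof -
  have q0: "q \<noteq> 0" using q by (simp add: is_canonical_poly_def)
  define c where "c = lead_coeff q ^ (Suc (degree p) - degree q)"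
  obtain r s where rs: "pseudo_divmod p q = (r, s)" by fastforce
  have eq: "smult c p = q * r + s" and s: "s = 0 \<or> degree s < degree q"
    using pseudo_divmod[OF q0 rs] by (auto simp: c_def)
  have "s = smult c p - q * r" by (simp add: eq)
  hence "poly (map_poly of_int s) x = 0"
    using q root by (simp add: map_poly_of_int_arith map_poly_of_int_mult is_canonical_poly_def)
  hence "s = 0" using s q by (auto simp: is_canonical_poly_def not_less[symmetric])
  hence eq: "smult c p = q * r" using eq by simp
  have c0: "c \<noteq> 0" using q0 by (simp add: c_def)
  have "content q = 1" using q by (simp add: is_canonical_poly_def)
  hence "content r = content (smult c p)" by (simp add: eq content_mult)
  hence "c dvd content r" by simp
  hence "[:c:] dvd r" by (simp add: const_poly_dvd_iff_dvd_content)
  then obtain r' where "r = smult c r'" by (auto elim: dvdE)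
  hence "smult c p = smult c (q * r')" using eq by simp
  thus ?thesis using c0 by (metis dvd_triv_left smult_cancel)
qed

lemma canonical_degree_pos:
  fixes x :: "'a::field_char_0"
  assumes "is_canonical_poly q x" shows "0 < degree q"
proof (rule ccontr)
  assume "\<not> ?thesis"
  then obtain d where "q = [:d:]" by (metis degree_eq_zeroE gr0I)
  thus False using assms by (auto simp: is_canonical_poly_def map_poly_pCons)
qed

text \<open>In degree at most 2, factors satisfy the height bound without a constant. A constant
  cofactor only divides the coefficients; for linear factors, the leading coefficient of
  \<open>q\<close> divides \<open>c\<close>, and its constant term, if nonzero, divides
  \<open>a\<close> or, when the cofactor has constant term 0, \<open>b\<close>.\<close>

lemma quadratic_factor_coeff_le:
  assumes qp: "q dvd triple_poly z" and z: "z \<noteq> (0, 0, 0)" and "0 < degree q"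
  shows "\<bar>coeff q i\<bar> \<le> height z"
proof -
  obtain a b c where abc: "z = (a, b, c)" by (cases z)
  obtain r where r: "[:a, b, c:] = q * r" using qp by (auto simp: abc triple_poly_def elim: dvdE)
  have nz: "q \<noteq> 0" "r \<noteq> 0" using r z by (auto simp: abc)
  have dvd_le: "\<bar>u\<bar> \<le> \<bar>v\<bar>" if "u * w = v" "v \<noteq> 0" for u v w :: int
    using that by (metis dvd_imp_le_int dvd_triv_left)
  have deg: "degree q + degree r \<le> 2"
  proof -
    have "degree (q * r) \<le> 2" unfolding r[symmetric] by simp
    thus ?thesis using nz by (simp add: degree_mult_eq)
  qed
  show ?thesis
  proof (cases "degree r = 0")
    case True
    then obtain d where d: "r = [:d:]" by (metis degree_eq_zeroE)
    have d0: "d \<noteq> 0" using nz d by auto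
    have "\<bar>coeff q i\<bar> \<le> \<bar>d * coeff q i\<bar>"
      using d0 by (metis abs_ge_zero abs_mult mult_le_cancel_right1 mult.commute int_one_le_iff_zero_less not_le zero_less_abs_iff)
    also have "d * coeff q i = coeff [:a, b, c:] i" using r d by simp
    also have "\<bar>\<dots>\<bar> \<le> height z"
      by (auto simp: abc height_def coeff_pCons split: nat.splits)
    finally show ?thesis .
  next
    case False
    hence dq: "degree q = 1" "degree r = 1" using deg assms(3) by auto
    have linear: "\<exists>v u. f = [:v, u:] \<and> u \<noteq> 0" if "degree f = 1" for f :: "int poly"
    proof (intro exI conjI)
      show "f = [:coeff f 0, coeff f 1:]"
        using that by (auto simp: poly_eq_iff coeff_pCons coeff_eq_0 split: nat.splits)
      show "coeff f 1 \<noteq> 0" using that by (metis leading_coeff_0_iff degree_0 zero_neq_one)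
    qed
    obtain v u s t where q: "q = [:v, u:]" "u \<noteq> 0" and rr: "r = [:s, t:]" "t \<noteq> 0"
      using linear[OF dq(1)] linear[OF dq(2)] by blast
    have eqs: "a = v * s" "b = v * t + u * s" "c = u * t"
      using r by (simp_all add: q rr algebra_simps)
    have "\<bar>u\<bar> \<le> \<bar>c\<bar>" using dvd_le[of u t c] eqs q rr by simp
    hence "\<bar>u\<bar> \<le> height z" using height_ge(3)[of c a b] unfolding abc by linarith
    moreover have "\<bar>v\<bar> \<le> height z"
    proof -
      consider "v = 0" | "v \<noteq> 0" "s = 0" | "v \<noteq> 0" "s \<noteq> 0" by blast
      thus ?thesis
      proof cases
        case 1
        thus ?thesis using height_ge_1[OF z] by simp
      next
        case 2
        hence "\<bar>v\<bar> \<le> \<bar>b\<bar>" using dvd_le[of v t b] eqs rr by simp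
        thus ?thesis using height_ge(2)[of b a c] unfolding abc by linarith
      next
        case 3
        hence "\<bar>v\<bar> \<le> \<bar>a\<bar>" using dvd_le[of v s a] eqs by simp
        thus ?thesis using height_ge(1)[of a b c] unfolding abc by linarith
      qed
    qed
    moreover have "coeff q i \<in> {v, u, 0}" by (auto simp: q coeff_pCons split: nat.splits)
    moreover have "0 \<le> height z" using height_ge_1[OF z] by simp
    ultimately show ?thesis by auto
  qed
qed

section \<open>Roots close to \<theta>, their degrees and heights\<close>

lemma poly_triple_poly:
  "poly (map_poly of_int (triple_poly (a, b, c))) x
     = of_int a + of_int b * x + of_int c * (x :: 'a::field_char_0)\<^sup>2"
  by (simp add: triple_poly_def map_poly_pCons algebra_simps power2_eq_square)

lemma form_eq_poly: "form \<theta> z = poly (map_poly of_int (triple_poly z)) \<theta>"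
  by (cases z) (simp add: form_def poly_triple_poly)

text \<open>With roots \<open>r1\<close>, \<open>r2\<close> the derivative at \<theta> is
  \<open>c * ((\<theta> - r1) + (\<theta> - r2))\<close>, at most \<open>2 * \<bar>c\<bar>\<close>
  times the larger distance. Multiplication by the smaller distance gives twice the form
  value.\<close>

lemma exists_near_root:
  assumes "form' \<theta> z \<noteq> 0"
  obtains \<xi> :: complex where "poly (map_poly of_int (triple_poly z)) \<xi> = 0"
    "norm (of_real \<theta> - \<xi>) * \<bar>form' \<theta> z\<bar> \<le> 2 * \<bar>form \<theta> z\<bar>"
proof -
  note root_found = that
  obtain a b c where z: "z = (a, b, c)" by (cases z)
  show ?thesis
  proof (cases "c = 0")
    case True
    hence b: "b \<noteq> 0" using assms by (auto simp: z form'_def)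
    define \<xi> :: complex where "\<xi> = - of_int a / of_int b"
    have "(of_real \<theta> - \<xi>) * of_int b = of_real (form \<theta> z)"
      using b True by (simp add: \<xi>_def z form_def field_simps)
    hence "norm (of_real \<theta> - \<xi>) * norm (of_int b :: complex) = norm (of_real (form \<theta> z) :: complex)"
      by (metis norm_mult)
    hence "norm (of_real \<theta> - \<xi>) * \<bar>form' \<theta> z\<bar> = \<bar>form \<theta> z\<bar>"
      using True by (simp add: z form'_def)
    moreover have "poly (map_poly of_int (triple_poly z)) \<xi> = 0"
      using b True by (simp add: \<xi>_def z poly_triple_poly)
    ultimately show ?thesis using that[of \<xi>] by simp
  next
    case False
    define s :: complex where "s = csqrt ((of_int b)\<^sup>2 - 4 * of_int a * of_int c)"
    have s2: "s\<^sup>2 = (of_int b)\<^sup>2 - 4 * of_int a * of_int c" by (simp add: s_def)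
    define r1 r2 :: complex where "r1 = (- of_int b + s) / (2 * of_int c)"
      and "r2 = (- of_int b - s) / (2 * of_int c)"
    have c: "(of_int c :: complex) \<noteq> 0" using False by simp
    have sum: "of_int c * (r1 + r2) = - of_int b" using c by (simp add: r1_def r2_def field_simps)
    have "4 * of_int c * (of_int c * (r1 * r2)) = (of_int b)\<^sup>2 - s\<^sup>2"
      using c by (simp add: r1_def r2_def field_simps power2_eq_square)
    hence prod: "of_int c * (r1 * r2) = of_int a" using c by (simp add: s2)
    have fac: "poly (map_poly of_int (triple_poly z)) x = of_int c * ((x - r1) * (x - r2))" for x
    proof -
      have "of_int c * ((x - r1) * (x - r2)) = of_int c * x\<^sup>2 - of_int c * (r1 + r2) * x + of_int c * (r1 * r2)"
        by (simp add: algebra_simps power2_eq_square)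
      thus ?thesis unfolding sum prod by (simp add: z poly_triple_poly)
    qed
    let ?t = "of_real \<theta> :: complex"
    have "of_real (form \<theta> z) = poly (map_poly of_int (triple_poly z)) ?t"
      by (simp add: z form_def poly_triple_poly)
    hence "norm (of_real (form \<theta> z) :: complex) = norm (of_int c * ((?t - r1) * (?t - r2)))"
      unfolding fac by simp
    hence L: "\<bar>form \<theta> z\<bar> = \<bar>of_int c\<bar> * (norm (?t - r1) * norm (?t - r2))"
      by (simp add: norm_mult)
    have "of_real (form' \<theta> z) = 2 * of_int c * ?t - of_int c * (r1 + r2)"
      unfolding sum by (simp add: z form'_def)
    also have "\<dots> = of_int c * ((?t - r1) + (?t - r2))" by (simp add: algebra_simps)
    finally have "norm (of_real (form' \<theta> z) :: complex) = norm (of_int c * ((?t - r1) + (?t - r2)))"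
      by simp
    hence "\<bar>form' \<theta> z\<bar> = \<bar>of_int c\<bar> * norm ((?t - r1) + (?t - r2))" by (simp add: norm_mult)
    hence D: "\<bar>form' \<theta> z\<bar> \<le> \<bar>of_int c\<bar> * (norm (?t - r1) + norm (?t - r2))"
      using norm_triangle_ineq[of "?t - r1" "?t - r2"] by (simp add: mult_left_mono)
    have main: ?thesis if le: "norm (?t - r) \<le> norm (?t - r')" and r: "{r, r'} = {r1, r2}" for r r'
    proof (rule root_found)
      show "poly (map_poly of_int (triple_poly z)) r = 0" using r by (auto simp: fac)
      have D': "\<bar>form' \<theta> z\<bar> \<le> \<bar>of_int c\<bar> * (norm (?t - r) + norm (?t - r'))"
        and L': "\<bar>form \<theta> z\<bar> = \<bar>of_int c\<bar> * (norm (?t - r) * norm (?t - r'))"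
        using r D L by (auto simp: doubleton_eq_iff add.commute mult.commute)
      have "\<bar>form' \<theta> z\<bar> \<le> \<bar>of_int c\<bar> * (2 * norm (?t - r'))"
        by (rule order_trans[OF D']) (use le in \<open>intro mult_left_mono; simp\<close>)
      hence "norm (?t - r) * \<bar>form' \<theta> z\<bar> \<le> norm (?t - r) * (\<bar>of_int c\<bar> * (2 * norm (?t - r')))"
        by (rule mult_left_mono) simp
      also have "\<dots> = 2 * \<bar>form \<theta> z\<bar>" unfolding L' by simp
      finally show "norm (?t - r) * \<bar>form' \<theta> z\<bar> \<le> 2 * \<bar>form \<theta> z\<bar>" .
    qed
    show ?thesis
    proof (cases "norm (?t - r1) \<le> norm (?t - r2)")
      case True
      show ?thesis by (rule main[OF True]) simp
    next
      case False
      show ?thesis by (rule main[of r2 r1]) (use False in auto)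
    qed
  qed
qed

lemma triple_poly_eq_0_iff: "triple_poly z = 0 \<longleftrightarrow> z = (0, 0, 0)"
  by (cases z) (simp add: triple_poly_def)

lemma degree_triple_poly: "degree (triple_poly z) \<le> 2"
  by (cases z) (simp add: triple_poly_def)

lemma root_of_triple_poly:
  fixes \<xi> :: "'a::field_char_0"
  assumes root: "poly (map_poly of_int (triple_poly z)) \<xi> = 0" and z: "z \<noteq> (0, 0, 0)"
  shows "algebraic \<xi>" "alg_degree \<xi> \<le> 2" "1 \<le> alg_height \<xi>" "alg_height \<xi> \<le> height z"
proof -
  show alg: "algebraic \<xi>"
  proof (rule algebraicI[OF _ _ root])
    have "triple_poly z \<noteq> 0" using z by (simp add: triple_poly_eq_0_iff)
    thus "map_poly of_int (triple_poly z) \<noteq> (0 :: 'a poly)"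
      by (auto simp: poly_eq_iff coeff_map_poly)
  qed (simp add: coeff_map_poly)
  define q where "q = canonical_poly \<xi>"
  have q: "is_canonical_poly q \<xi>" unfolding q_def by (rule is_canonical_poly_canonical_poly[OF alg])
  have dvd: "q dvd triple_poly z" by (rule canonical_poly_dvd[OF q root])
  hence "degree q \<le> degree (triple_poly z)" using z by (intro dvd_imp_degree_le) (simp_all add: triple_poly_eq_0_iff)
  also have "\<dots> \<le> 2" by (rule degree_triple_poly)
  finally show "alg_degree \<xi> \<le> 2" by (simp add: alg_degree_def q_def)
  define S where "S = {\<bar>coeff q i\<bar> | i. i \<le> degree q}"
  have S: "finite S" unfolding S_def by simp
  have lead: "\<bar>coeff q (degree q)\<bar> \<in> S" "1 \<le> \<bar>coeff q (degree q)\<bar>"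
    using q unfolding S_def is_canonical_poly_def by (blast, simp)
  have H: "alg_height \<xi> = Max S" by (simp add: alg_height_def q_def S_def)
  show "1 \<le> alg_height \<xi>" unfolding H using Max_ge[OF S lead(1)] lead(2) by linarith
  show "alg_height \<xi> \<le> height z" unfolding H
  proof (rule Max.boundedI[OF S])
    show "S \<noteq> {}" using lead(1) by blast
    show "x \<le> height z" if "x \<in> S" for x
      using that quadratic_factor_coeff_le[OF dvd z canonical_degree_pos[OF q]] by (auto simp: S_def)
  qed
qed

lemma form_nonzero:
  assumes "\<theta> \<notin> \<rat>" "\<not> quadratic_irrational \<theta>" "z \<noteq> (0, 0, 0)"
  shows "form \<theta> z \<noteq> 0"
proof
  assume "form \<theta> z = 0"
  hence root: "poly (map_poly of_int (triple_poly z)) \<theta> = 0" by (simp add: form_eq_poly)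
  note alg = root_of_triple_poly[OF root assms(3)]
  define q where "q = canonical_poly \<theta>"
  have q: "is_canonical_poly q \<theta>" unfolding q_def by (rule is_canonical_poly_canonical_poly[OF alg(1)])
  have "degree q \<noteq> 2" using assms(2) alg(1) by (auto simp: quadratic_irrational_def alg_degree_def q_def)
  hence deg: "degree q = 1" using alg(2) canonical_degree_pos[OF q] by (simp add: alg_degree_def q_def)
  have q_eq: "q = [:coeff q 0, coeff q 1:]"
    using deg by (auto simp: poly_eq_iff coeff_pCons coeff_eq_0 split: nat.splits)
  have u: "coeff q 1 \<noteq> 0" using deg by (metis leading_coeff_0_iff degree_0 zero_neq_one)
  have "poly (map_poly of_int [:coeff q 0, coeff q 1:]) \<theta> = 0"
    using q unfolding q_eq[symmetric] by (simp add: is_canonical_poly_def)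
  hence "of_int (coeff q 0) + of_int (coeff q 1) * \<theta> = 0" by (simp add: map_poly_pCons algebra_simps)
  hence "\<theta> = - of_int (coeff q 0) / of_int (coeff q 1)" using u by (simp add: field_simps)
  thus False using assms(1) by auto
qed

text \<open>The near root is either outside the finite set, hence at distance more than
  \<open>alg_height \<xi> powr - \<sigma>\<close> from \<theta>, or inside it, hence at least a
  fixed \<open>d\<close> away, because \<theta> itself is never a root.\<close>

lemma derivative_bound_of_finite:
  assumes nz: "\<And>z. z \<noteq> (0, 0, 0) \<Longrightarrow> form \<theta> z \<noteq> 0" and \<sigma>: "0 \<le> \<sigma>"
    and fin: "finite {\<xi> :: complex. algebraic \<xi> \<and> alg_degree \<xi> \<le> 2 \<and>
      norm (complex_of_real \<theta> - \<xi>) \<le> real_of_int (alg_height \<xi>) powr (- \<sigma>)}"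
  shows "\<exists>K. \<forall>z. z \<noteq> (0, 0, 0) \<longrightarrow> \<bar>form' \<theta> z\<bar> \<le> K * \<bar>form \<theta> z\<bar> * height z powr \<sigma>"
proof -
  define S where "S = {\<xi> :: complex. algebraic \<xi> \<and> alg_degree \<xi> \<le> 2 \<and>
      norm (complex_of_real \<theta> - \<xi>) \<le> real_of_int (alg_height \<xi>) powr (- \<sigma>)}"
  obtain d where d: "0 < d" "\<And>\<xi>. \<xi> \<in> S \<Longrightarrow> \<xi> \<noteq> of_real \<theta> \<Longrightarrow> d \<le> dist (of_real \<theta>) \<xi>"
    using finite_set_avoid[OF fin[folded S_def], of "of_real \<theta>"] by blast
  have "\<bar>form' \<theta> z\<bar> \<le> (2 + 2 / d) * \<bar>form \<theta> z\<bar> * height z powr \<sigma>" if z: "z \<noteq> (0, 0, 0)" for z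
  proof (cases "form' \<theta> z = 0")
    case True
    thus ?thesis using d by simp
  next
    case False
    obtain \<xi> :: complex where root: "poly (map_poly of_int (triple_poly z)) \<xi> = 0"
      and near: "norm (of_real \<theta> - \<xi>) * \<bar>form' \<theta> z\<bar> \<le> 2 * \<bar>form \<theta> z\<bar>"
      using exists_near_root[OF False] .
    note alg = root_of_triple_poly[OF root z]
    have ne: "\<xi> \<noteq> of_real \<theta>"
    proof
      assume eq: "\<xi> = of_real \<theta>"
      have "of_real (form \<theta> z) = poly (map_poly of_int (triple_poly z)) (of_real \<theta> :: complex)"
        by (cases z) (simp add: form_def poly_triple_poly)
      thus False using nz[OF z] root eq by simp
    qed
    have h: "1 \<le> height z" by (rule height_ge_1[OF z])
    have pw: "1 \<le> height z powr \<sigma>" using h \<sigma> by (intro ge_one_powr_ge_zero) auto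
    have "min d (height z powr - \<sigma>) \<le> norm (of_real \<theta> - \<xi>)"
    proof (cases "\<xi> \<in> S")
      case True
      thus ?thesis using d(2)[OF True ne] by (simp add: dist_norm)
    next
      case False
      hence "alg_height \<xi> powr - \<sigma> < norm (of_real \<theta> - \<xi>)" using alg by (auto simp: S_def)
      moreover have "height z powr - \<sigma> \<le> alg_height \<xi> powr - \<sigma>"
        using alg(3,4) \<sigma> by (intro powr_mono2') auto
      ultimately show ?thesis by simp
    qed
    hence "min d (height z powr - \<sigma>) * \<bar>form' \<theta> z\<bar> \<le> 2 * \<bar>form \<theta> z\<bar>"
      by (intro order_trans[OF mult_right_mono near]) auto
    hence "d * \<bar>form' \<theta> z\<bar> \<le> 2 * \<bar>form \<theta> z\<bar> \<or> height z powr - \<sigma> * \<bar>form' \<theta> z\<bar> \<le> 2 * \<bar>form \<theta> z\<bar>"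
      by (auto simp: min_def split: if_splits)
    hence "\<bar>form' \<theta> z\<bar> \<le> 2 / d * \<bar>form \<theta> z\<bar> \<or> \<bar>form' \<theta> z\<bar> \<le> 2 * \<bar>form \<theta> z\<bar> * height z powr \<sigma>"
      using d(1) h by (simp add: field_simps powr_minus)
    moreover have "2 / d * \<bar>form \<theta> z\<bar> * 1 \<le> (2 + 2 / d) * \<bar>form \<theta> z\<bar> * height z powr \<sigma>"
      using d(1) pw by (intro mult_mono) auto
    moreover have "2 * \<bar>form \<theta> z\<bar> * height z powr \<sigma> \<le> (2 + 2 / d) * \<bar>form \<theta> z\<bar> * height z powr \<sigma>"
      using d(1) by (intro mult_right_mono) auto
    ultimately show ?thesis by linarith
  qed
  thus ?thesis by blast
qed

text \<open>The factor 3 bounds the Euclidean length by the sum of the absolute coordinates.\<close>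

lemma form_value_of_triple:
  assumes "z \<noteq> (0, 0, 0)" "3 * real_of_int (height z) \<le> t"
  shows "\<bar>form \<theta> z\<bar> \<in> form_values \<theta> t"
proof -
  obtain a b c where z: "z = (a, b, c)" by (cases z)
  define x :: "real ^ 3" where "x = vector [of_int a, of_int b, of_int c]"
  have x: "x $ 1 = of_int a" "x $ 2 = of_int b" "x $ 3 = of_int c" by (simp_all add: x_def)
  have "norm x \<le> (\<Sum>i\<in>UNIV. \<bar>x $ i\<bar>)" by (rule norm_le_l1_cart)
  also have "\<dots> = of_int (\<bar>a\<bar> + \<bar>b\<bar> + \<bar>c\<bar>)" by (simp add: sum_3 x)
  also have "\<dots> \<le> of_int (3 * height z)"
    using height_ge(1)[of a b c] height_ge(2)[of b a c] height_ge(3)[of c a b]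
    unfolding of_int_le_iff z by linarith
  finally have "norm x \<le> t" using assms(2) by simp
  moreover have "x \<noteq> 0"
  proof
    assume "x = 0"
    hence "x $ 1 = 0" "x $ 2 = 0" "x $ 3 = 0" by simp_all
    thus False using assms(1) by (simp add: x z)
  qed
  moreover have "\<forall>i. x $ i \<in> \<int>" by (simp add: forall_3 x)
  moreover have "\<bar>form \<theta> z\<bar> = \<bar>x $ 1 + x $ 2 * \<theta> + x $ 3 * \<theta>\<^sup>2\<bar>" by (simp add: z form_def x)
  ultimately show ?thesis unfolding form_values_def by auto
qed

lemma triple_of_form_value:
  assumes "v \<in> form_values \<theta> t"
  obtains z where "z \<noteq> (0, 0, 0)" "real_of_int (height z) \<le> t" "v = \<bar>form \<theta> z\<bar>"
proof -
  obtain x :: "real ^ 3" where x: "\<forall>i. x $ i \<in> \<int>" "0 < norm x" "norm x \<le> t"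
    "v = \<bar>x $ 1 + x $ 2 * \<theta> + x $ 3 * \<theta>\<^sup>2\<bar>"
    using assms unfolding form_values_def by auto
  define z where "z = (\<lfloor>x $ 1\<rfloor>, \<lfloor>x $ 2\<rfloor>, \<lfloor>x $ 3\<rfloor>)"
  have fl: "of_int \<lfloor>x $ i\<rfloor> = x $ i" for i using x(1) by (metis Ints_cases floor_of_int)
  have le: "\<bar>of_int \<lfloor>x $ i\<rfloor>\<bar> \<le> t" for i
    unfolding fl using component_le_norm_cart[of x i] x(3) by linarith
  show ?thesis
  proof
    show "z \<noteq> (0, 0, 0)"
    proof
      assume "z = (0, 0, 0)"
      hence "x $ 1 = 0" "x $ 2 = 0" "x $ 3 = 0" using fl[of 1] fl[of 2] fl[of 3] by (simp_all add: z_def)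
      hence "x = 0" by (simp add: vec_eq_iff forall_3)
      thus False using x(2) by simp
    qed
    have "height z \<in> {\<bar>\<lfloor>x $ 1\<rfloor>\<bar>, \<bar>\<lfloor>x $ 2\<rfloor>\<bar>, \<bar>\<lfloor>x $ 3\<rfloor>\<bar>}" by (auto simp: z_def height_def max_def)
    thus "height z \<le> t" using le[of 1] le[of 2] le[of 3] by auto
    show "v = \<bar>form \<theta> z\<bar>" by (simp add: z_def form_def fl x(4))
  qed
qed

section \<open>The exponents\<close>

definition uniform_exponents :: "real \<Rightarrow> real set" where
  "uniform_exponents \<theta> =
     {\<gamma>. Limsup at_top (\<lambda>t::real. ereal (t powr \<gamma> * Min (form_values \<theta> t))) < \<infinity>}"

lemma omega_hat_eq: "omega_hat \<theta> = Sup (ereal ` uniform_exponents \<theta>)"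
  unfolding omega_hat_def uniform_exponents_def by (rule arg_cong[where f = Sup]) auto

text \<open>The limit superior controls only \<open>t\<close> beyond some \<open>T\<close>. Below
  \<open>T\<close> the vector \<open>(1, 0, 0)\<close> with form value 1 serves, at the cost of a
  larger constant.\<close>

lemma uniform_exponent_triples:
  assumes "\<gamma> \<in> uniform_exponents \<theta>" "0 \<le> \<gamma>"
  obtains C where "\<And>t :: real. 1 \<le> t \<Longrightarrow> \<exists>z. z \<noteq> (0, 0, 0) \<and> real_of_int (height z) \<le> t \<and>
    \<bar>form \<theta> z\<bar> \<le> C * t powr - \<gamma>"
proof -
  obtain C where C: "Limsup at_top (\<lambda>t::real. ereal (t powr \<gamma> * Min (form_values \<theta> t))) < ereal C"
    using assms(1) ereal_dense2[of _ \<infinity>] unfolding uniform_exponents_def by blast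
  hence "\<forall>\<^sub>F t :: real in at_top. ereal (t powr \<gamma> * Min (form_values \<theta> t)) < ereal C"
    by (rule Limsup_lessD)
  then obtain T where T: "\<And>t. T \<le> t \<Longrightarrow> t powr \<gamma> * Min (form_values \<theta> t) < C"
    unfolding eventually_at_top_linorder by auto
  define C' where "C' = max C (max 1 T powr \<gamma>)"
  have "\<exists>z. z \<noteq> (0, 0, 0) \<and> real_of_int (height z) \<le> t \<and> \<bar>form \<theta> z\<bar> \<le> C' * t powr - \<gamma>"
    if t: "1 \<le> t" for t
  proof (cases "T \<le> t")
    case True
    have "Min (form_values \<theta> t) \<in> form_values \<theta> t"
      using finite_form_values form_values_nonempty[OF t] by (rule Min_in)
    then obtain z where z: "z \<noteq> (0, 0, 0)" "height z \<le> t" "Min (form_values \<theta> t) = \<bar>form \<theta> z\<bar>"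
      by (rule triple_of_form_value)
    have "t powr \<gamma> * \<bar>form \<theta> z\<bar> \<le> C'" using T[OF True] z(3) by (simp add: C'_def)
    hence "\<bar>form \<theta> z\<bar> \<le> C' * t powr - \<gamma>" using t by (simp add: powr_minus field_simps)
    thus ?thesis using z by blast
  next
    case False
    have "t powr \<gamma> \<le> max 1 T powr \<gamma>" using False t assms(2) by (intro powr_mono2) auto
    hence "1 \<le> C' * t powr - \<gamma>" using t by (simp add: C'_def powr_minus field_simps)
    thus ?thesis using t by (intro exI[of _ "(1, 0, 0)"]) (simp add: height_def form_def)
  qed
  thus ?thesis using that by blast
qed

lemma ex_small_form:
  assumes n: "1 \<le> n"
  shows "\<exists>z. z \<noteq> (0, 0, 0) \<and> height z \<le> int n \<and> \<bar>form \<theta> z\<bar> \<le> 2 * (1 + \<bar>\<theta>\<bar> + \<theta>\<^sup>2) / (real n)\<^sup>2"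
proof -
  define M where "M = 1 + \<bar>\<theta>\<bar> + \<theta>\<^sup>2"
  have M: "1 \<le> M" by (simp add: M_def)
  \<comment> \<open>The values on \<open>G\<close> lie in an interval of length
    \<open>2 * M * n\<close>, and this is its \<open>n ^ 3\<close>-th part.\<close>
  define \<delta> where "\<delta> = 2 * M / (real n)\<^sup>2"
  have \<delta>: "0 < \<delta>" using M n by (simp add: \<delta>_def)
  \<comment> \<open>Pigeonhole: \<open>(n + 1)\<^sup>3\<close> vectors, whose values fall into \<open>n\<^sup>3 + 1\<close> intervals of length \<open>\<delta>\<close>.\<close>
  define G where "G = {0..int n} \<times> {0..int n} \<times> {0..int n}"
  define f where "f z = \<lfloor>(form \<theta> z + M * n) / \<delta>\<rfloor>" for z
  have "f ` G \<subseteq> {0..int n ^ 3}"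
  proof (rule image_subsetI)
    fix z assume "z \<in> G"
    then obtain a b c where z: "z = (a, b, c)" "a \<in> {0..int n}" "b \<in> {0..int n}" "c \<in> {0..int n}"
      by (auto simp: G_def)
    have abc: "0 \<le> real_of_int a" "real_of_int a \<le> n" "0 \<le> real_of_int b" "real_of_int b \<le> n"
      "0 \<le> real_of_int c" "real_of_int c \<le> n" using z by auto
    have "\<bar>form \<theta> z\<bar> \<le> real_of_int a + real_of_int b * \<bar>\<theta>\<bar> + real_of_int c * \<theta>\<^sup>2"
    proof -
      have "\<bar>form \<theta> z\<bar> \<le> \<bar>real_of_int a\<bar> + \<bar>real_of_int b * \<theta>\<bar> + \<bar>real_of_int c * \<theta>\<^sup>2\<bar>"
        unfolding z form_def by simp
      thus ?thesis using abc by (simp add: abs_mult)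
    qed
    also have "\<dots> \<le> n + n * \<bar>\<theta>\<bar> + n * \<theta>\<^sup>2" using abc by (intro add_mono mult_right_mono) auto
    finally have "\<bar>form \<theta> z\<bar> \<le> M * n" by (simp add: M_def algebra_simps)
    hence *: "0 \<le> form \<theta> z + M * n" "form \<theta> z + M * n \<le> 2 * M * n" by auto
    have "(form \<theta> z + M * n) / \<delta> \<le> (2 * M * n) / \<delta>" using * \<delta> by (intro divide_right_mono) auto
    also have "\<dots> = real_of_int (int n ^ 3)"
      using M n by (simp add: \<delta>_def field_simps power2_eq_square power3_eq_cube)
    finally have "f z \<le> int n ^ 3" unfolding f_def by (simp add: floor_le_iff)
    moreover have "0 \<le> f z" unfolding f_def using * \<delta> by simp
    ultimately show "f z \<in> {0..int n ^ 3}" by simp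
  qed
  hence "card (f ` G) \<le> card {0..int n ^ 3}" by (intro card_mono) auto
  also have "\<dots> = n ^ 3 + 1" by (simp add: nat_add_distrib nat_power_eq)
  also have "\<dots> < (n + 1) ^ 3" using n by (simp add: power3_eq_cube algebra_simps)
  also have "\<dots> = card G" by (simp add: G_def card_cartesian_product power3_eq_cube nat_add_distrib)
  finally have "\<not> inj_on f G" using pigeonhole by blast
  then obtain y z where yz: "y \<in> G" "z \<in> G" "y \<noteq> z" "f y = f z" unfolding inj_on_def by blast
  obtain a b c a' b' c' where e: "y = (a, b, c)" "z = (a', b', c')" by (cases y, cases z)
  define w where "w = (a - a', b - b', c - c')"
  have "w \<noteq> (0, 0, 0)" using yz(3) by (auto simp: w_def e)
  moreover have "height w \<le> int n" using yz(1,2) by (auto simp: w_def e G_def height_def)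
  moreover have "\<bar>form \<theta> w\<bar> \<le> \<delta>"
  proof -
    have "form \<theta> w = form \<theta> y - form \<theta> z" by (simp add: w_def e form_def algebra_simps)
    moreover have "\<bar>(form \<theta> y + M * n) / \<delta> - (form \<theta> z + M * n) / \<delta>\<bar> < 1"
      using yz(4) unfolding f_def by linarith
    hence "\<bar>(form \<theta> y - form \<theta> z) / \<delta>\<bar> < 1" by (simp add: diff_divide_distrib add_divide_distrib)
    ultimately show ?thesis using \<delta> by (simp add: field_simps)
  qed
  ultimately show ?thesis unfolding \<delta>_def M_def by blast
qed

text \<open>Dirichlet's exponent for three unknowns. The choice
  \<open>n = nat \<lfloor>t / 3\<rfloor>\<close> keeps the Euclidean length below \<open>t\<close>,
  and \<open>t \<le> 6 * n\<close> yields \<open>72 = 36 * 2\<close>.\<close>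

lemma two_uniform_exponent: "2 \<in> uniform_exponents \<theta>"
proof -
  define C where "C = 72 * (1 + \<bar>\<theta>\<bar> + \<theta>\<^sup>2)"
  have "t powr 2 * Min (form_values \<theta> t) \<le> C" if t: "3 \<le> t" for t :: real
  proof -
    define n where "n = nat \<lfloor>t / 3\<rfloor>"
    have floor: "1 \<le> \<lfloor>t / 3\<rfloor>" using t by (simp add: le_floor_iff)
    hence "real n = of_int \<lfloor>t / 3\<rfloor>" by (simp add: n_def)
    hence n: "1 \<le> n" "real n \<le> t / 3" "t / 3 < real n + 1" using floor by linarith+
    obtain z where z: "z \<noteq> (0, 0, 0)" "height z \<le> int n"
      "\<bar>form \<theta> z\<bar> \<le> 2 * (1 + \<bar>\<theta>\<bar> + \<theta>\<^sup>2) / (real n)\<^sup>2"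
      using ex_small_form[OF n(1)] by blast
    have "real_of_int (height z) \<le> real n" using z(2) by (metis of_int_le_iff of_int_of_nat_eq)
    hence "\<bar>form \<theta> z\<bar> \<in> form_values \<theta> t" using z(1) n by (intro form_value_of_triple) auto
    hence "Min (form_values \<theta> t) \<le> \<bar>form \<theta> z\<bar>" by (intro Min_le finite_form_values)
    hence "t\<^sup>2 * Min (form_values \<theta> t) \<le> t\<^sup>2 * \<bar>form \<theta> z\<bar>" by (rule mult_left_mono) simp
    also have "\<dots> \<le> (6 * real n)\<^sup>2 * (2 * (1 + \<bar>\<theta>\<bar> + \<theta>\<^sup>2) / (real n)\<^sup>2)"
    proof (rule mult_mono[OF power_mono z(3)])
      have "1 \<le> real n" using n(1) by simp
      thus "t \<le> 6 * real n" using n(3) by linarith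
    qed (use t in auto)
    also have "\<dots> = C" using n by (simp add: C_def power_mult_distrib)
    finally show ?thesis using t by simp
  qed
  hence "\<forall>\<^sub>F t :: real in at_top. ereal (t powr 2 * Min (form_values \<theta> t)) \<le> ereal C"
    by (intro eventually_at_top_linorderI[of 3]) auto
  hence "Limsup at_top (\<lambda>t :: real. ereal (t powr 2 * Min (form_values \<theta> t))) \<le> ereal C"
    by (rule Limsup_bounded)
  thus ?thesis unfolding uniform_exponents_def by (auto elim: le_less_trans)
qed

text \<open>For each small \<epsilon>, finiteness of the set of approximations would bound the
  derivative as in \<open>derivative_not_uniformly_small\<close>; then \<epsilon> tends to
  0.\<close>

lemma omega_star_ge:
  assumes \<theta>: "\<theta> \<notin> \<rat>" "\<not> quadratic_irrational \<theta>" and \<gamma>: "\<gamma> \<in> uniform_exponents \<theta>" "2 \<le> \<gamma>"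
  shows "ereal (\<gamma>\<^sup>2 - \<gamma> + 1) \<le> omega_star \<theta>"
proof -
  have *: "ereal (\<gamma>\<^sup>2 - \<gamma> + 1 - \<epsilon>) \<le> omega_star \<theta>" if \<epsilon>: "0 < \<epsilon>" "\<epsilon> \<le> 1/2" for \<epsilon>
  proof -
    define \<sigma> where "\<sigma> = \<gamma>\<^sup>2 - \<gamma> + 1 - \<epsilon>"
    have "0 \<le> \<gamma> * (\<gamma> - 1)" using \<gamma>(2) by simp
    hence \<sigma>: "0 \<le> \<sigma>" using \<epsilon> by (simp add: \<sigma>_def power2_eq_square algebra_simps)
    obtain C where C: "\<And>t :: real. 1 \<le> t \<Longrightarrow> \<exists>z. z \<noteq> (0, 0, 0) \<and> real_of_int (height z) \<le> t \<and>
      \<bar>form \<theta> z\<bar> \<le> C * t powr - \<gamma>"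
      by (rule uniform_exponent_triples[OF \<gamma>(1)]) (use \<gamma>(2) in auto)
    have "infinite {\<xi> :: complex. algebraic \<xi> \<and> alg_degree \<xi> \<le> 2 \<and>
      norm (complex_of_real \<theta> - \<xi>) \<le> real_of_int (alg_height \<xi>) powr (- \<sigma>)}"
    proof
      assume "finite {\<xi> :: complex. algebraic \<xi> \<and> alg_degree \<xi> \<le> 2 \<and>
        norm (complex_of_real \<theta> - \<xi>) \<le> real_of_int (alg_height \<xi>) powr (- \<sigma>)}"
      from derivative_bound_of_finite[OF form_nonzero[OF \<theta>] \<sigma> this]
      obtain K where K: "\<And>z. z \<noteq> (0, 0, 0) \<Longrightarrow> \<bar>form' \<theta> z\<bar> \<le> K * \<bar>form \<theta> z\<bar> * height z powr \<sigma>" by blast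
      show False
        by (rule derivative_not_uniformly_small[OF form_nonzero[OF \<theta>] C \<gamma>(2) \<epsilon> K[unfolded \<sigma>_def]])
    qed
    thus ?thesis unfolding omega_star_def \<sigma>_def[symmetric] by (intro Sup_upper) blast
  qed
  show ?thesis
  proof (rule ereal_le_epsilon2)
    fix e :: real assume e: "0 < e"
    define \<delta> where "\<delta> = min e (1/2)"
    have \<delta>: "0 < \<delta>" "\<delta> \<le> 1/2" "\<delta> \<le> e" using e by (auto simp: \<delta>_def)
    have "ereal (\<gamma>\<^sup>2 - \<gamma> + 1) = ereal (\<gamma>\<^sup>2 - \<gamma> + 1 - \<delta>) + ereal \<delta>" by simp
    also have "\<dots> \<le> omega_star \<theta> + ereal e" using \<delta> by (intro add_mono *) auto
    finally show "ereal (\<gamma>\<^sup>2 - \<gamma> + 1) \<le> omega_star \<theta> + ereal e" .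
  qed
qed

theorem theorem2:
  fixes \<theta> :: real
  assumes "\<theta> \<notin> \<rat>"
    and "\<not> quadratic_irrational \<theta>"
  shows "omega_star \<theta> \<ge> (omega_hat \<theta>)\<^sup>2 - omega_hat \<theta> + 1"
proof (cases "omega_star \<theta>")
  case PInf
  thus ?thesis by simp
next
  case MInf
  thus ?thesis using omega_star_ge[OF assms two_uniform_exponent] by simp
next
  case (real s)
  \<comment> \<open>The larger root of \<open>x\<^sup>2 - x + 1 = s\<close>, so an upper bound for
    all uniform exponents.\<close>
  define B where "B = 1/2 + sqrt (s - 3/4)"
  have "3 \<le> s" using omega_star_ge[OF assms two_uniform_exponent] real by simp
  hence B: "B\<^sup>2 - B + 1 = s"
    by (simp add: B_def power2_eq_square algebra_simps)
  have "\<gamma> \<le> B" if "\<gamma> \<in> uniform_exponents \<theta>" for \<gamma>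
  proof (cases "2 \<le> \<gamma>")
    case True
    hence "\<gamma>\<^sup>2 - \<gamma> + 1 \<le> s" using omega_star_ge[OF assms that] real by simp
    hence "(\<gamma> - 1/2)\<^sup>2 \<le> s - 3/4" by (simp add: power2_eq_square algebra_simps)
    hence "\<gamma> - 1/2 \<le> sqrt (s - 3/4)" by (rule real_le_rsqrt)
    thus ?thesis by (simp add: B_def)
  next
    case False
    \<comment> \<open>From \<open>3 \<le> s\<close> follows \<open>2 \<le> B\<close>, which settles
      the exponents below 2.\<close>
    have "(3/2)\<^sup>2 \<le> s - 3/4" using \<open>3 \<le> s\<close> by (simp add: power2_eq_square)
    hence "3/2 \<le> sqrt (s - 3/4)" by (rule real_le_rsqrt)
    thus ?thesis using False by (simp add: B_def)
  qed
  hence upper: "omega_hat \<theta> \<le> ereal B" unfolding omega_hat_eq by (intro Sup_least) auto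
  \<comment> \<open>The lower bound 2 excludes minus infinity and places \<open>w\<close> to the
    right of 1/2, where the quadratic is increasing.\<close>
  have "ereal 2 \<le> omega_hat \<theta>" unfolding omega_hat_eq using two_uniform_exponent by (intro Sup_upper) auto
  then obtain w where w: "omega_hat \<theta> = ereal w" "2 \<le> w" "w \<le> B"
    using upper by (cases "omega_hat \<theta>") auto
  have "(w - 1/2)\<^sup>2 \<le> (B - 1/2)\<^sup>2" using w by (intro power_mono) auto
  hence "w\<^sup>2 - w + 1 \<le> s" unfolding B[symmetric] by (simp add: power2_eq_square algebra_simps)
  thus ?thesis unfolding real w(1) by (simp add: one_ereal_def)
qed

end
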